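(* Let $N\ge1$ be an integer, $a\in\mathbb{R}$, and let $P_n$, $P_n^*$, $g_N$ be as in the context. Put $\alpha_j=2a\cos(2j\pi/N)$ for $j\ge0$, and for $z\in\mathbb{C}\setminus\mathbb{R}$ let $$\varphi(z)=\cfrac{2}{2z-\alpha_0-\cfrac{1}{2z-\alpha_1-\cfrac{1}{2z-\alpha_2-\cdots}}}=\lim_{n\to\infty}\frac{P_n^*(z)}{P_n(z)}.$$ Let $\xi_1<\xi_2\le\xi_3<\xi_4\le\cdots\le\xi_{2N-1}<\xi_{2N}$ be the roots (counting multiplicity) of $g_N^2(x)=1$. Then $$\varphi(z)=\frac{2\left[P_N(z)-g_N(z)-\sqrt{g_N^2(z)-1}\right]}{P_{N-1}(z)},\qquad\text{where}\quad \sqrt{g_N^2(z)-1}=2^{N-1}\prod_{j=1}^{2N}(z-\xi_j)^{1/2}.$$ Let $y_1<\cdots<y_{N-1}$ be the zeros of $P_{N-1}(x)$. Then for $k=1,\ldots,N-1$, $$m_k:=\lim_{z\to y_k}\left[(z-y_k)\varphi(z)\right]=\begin{cases}0,&|P_N(y_k)|\ge1,\\[2pt] \dfrac{4\sqrt{|g_N^2(y_k)-1|}}{|P_{N-1}'(y_k)|},&|P_N(y_k)|<1.\end{cases}$$ In particular, if $y_k=\xi_{2k}=\xi_{2k+1}$ is a double root of $g_N^2(x)=1$, then $P_N(y_k)=g_N(y_k)=(-1)^{N-k}$ and $\varphi(z)$ has a removable singularity at $y_k$ (i.e. the factor $z-y_k$ of the denominator $P_{N-1}(z)$ cancels against the numerator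 in the formula for $\varphi$).
   Context: Let $q=e^{2\pi i/N}$, so $a(q^n+q^{-n})=2a\cos(2\pi n/N)$. The polynomials $P_n(x)$ are defined by $P_0(x)=1$, $P_1(x)=2x-2a$ and $$2xP_n(x)=P_{n+1}(x)+a(q^n+q^{-n})P_n(x)+P_{n-1}(x),\quad n\ge1.$$ The numerator polynomials $P_n^*(x)$ are defined by the same recurrence for $n\ge 1$ with $P_0^*(x)=0$ and $P_1^*(x)=2$. The polynomial $$g_N(x)=\frac{P_N(x)-P_{N-1}^*(x)/2}{2}$$ has degree $N$ and leading coefficient $2^{N-1}$; the $2N$ roots of $g_N^2(x)=1$ are all real, and can be ordered as in the claim. The powers $(z-\xi_j)^{1/2}$ are principal branches. The limit $z\to y_k$ is taken through $z\in\mathbb{C}\setminus\mathbb{R}$. *)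

theory Defs
  imports "HOL-Analysis.Analysis" "HOL-Computational_Algebra.Polynomial"
begin

text \<open>With \<open>q = exp (2 \<pi> \<i> / N)\<close> one has \<open>alpha a N n = a (q ^ n + q ^ (-n))\<close>.\<close>

definition alpha :: "real \<Rightarrow> nat \<Rightarrow> nat \<Rightarrow> real" where
  "alpha a N n = 2 * a * cos (2 * real n * pi / real N)"

fun Ppoly :: "real \<Rightarrow> nat \<Rightarrow> nat \<Rightarrow> real poly" where
  "Ppoly a N 0 = 1"
| "Ppoly a N (Suc 0) = [:- 2 * a, 2:]"
| "Ppoly a N (Suc (Suc n)) = [:- alpha a N (Suc n), 2:] * Ppoly a N (Suc n) - Ppoly a N n"

fun Pstar :: "real \<Rightarrow> nat \<Rightarrow> nat \<Rightarrow> real poly" where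
  "Pstar a N 0 = 0"
| "Pstar a N (Suc 0) = 2"
| "Pstar a N (Suc (Suc n)) = [:- alpha a N (Suc n), 2:] * Pstar a N (Suc n) - Pstar a N n"

definition discr_poly :: "real \<Rightarrow> nat \<Rightarrow> real poly" where
  "discr_poly a N = smult (1/2) (Ppoly a N N - smult (1/2) (Pstar a N (N - 1)))"

abbreviation cpoly :: "real poly \<Rightarrow> complex \<Rightarrow> complex" where
  "cpoly p z \<equiv> poly (map_poly complex_of_real p) z"

text \<open>\<open>cf_tail a N z j n\<close> is the tail
  \<open>1 / (2 z - \<alpha>\<^sub>j - 1 / (2 z - \<alpha>\<^sub>j\<^sub>+\<^sub>1 - \<dots>))\<close> of the continued fraction, truncated after
  \<open>n\<close> levels.\<close>

fun cf_tail :: "real \<Rightarrow> nat \<Rightarrow> complex \<Rightarrow> nat \<Rightarrow> nat \<Rightarrow> complex" where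
  "cf_tail a N z j 0 = 0"
| "cf_tail a N z j (Suc n) =
     1 / (2 * z - complex_of_real (alpha a N j) - cf_tail a N z (Suc j) n)"

definition cf_convergent :: "real \<Rightarrow> nat \<Rightarrow> complex \<Rightarrow> nat \<Rightarrow> complex" where
  "cf_convergent a N z n = 2 / (2 * z - complex_of_real (alpha a N 0) - cf_tail a N z 1 n)"

definition phi :: "real \<Rightarrow> nat \<Rightarrow> complex \<Rightarrow> complex" where
  "phi a N z = lim (cf_convergent a N z)"

definition sqrt_branch :: "nat \<Rightarrow> (nat \<Rightarrow> real) \<Rightarrow> complex \<Rightarrow> complex" where
  "sqrt_branch N \<xi> z = 2 ^ (N - 1) * (\<Prod>j = 1..2 * N. csqrt (z - complex_of_real (\<xi> j)))"

text \<open>For a function \<open>f\<close> given off the real line, and possibly having a jump across it, a real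
  point is never an isolated singularity. Removability at \<open>y\<close> therefore means that the
  restrictions of \<open>f\<close> to the upper and to the lower half plane both extend holomorphically
  to a neighbourhood of \<open>y\<close>.\<close>

definition removable_off_reals_at :: "(complex \<Rightarrow> complex) \<Rightarrow> real \<Rightarrow> bool" where
  "removable_off_reals_at f y \<longleftrightarrow>
     (\<exists>r > 0. \<exists>F. F holomorphic_on ball (complex_of_real y) r \<and>
        (\<forall>z \<in> ball (complex_of_real y) r. Im z > 0 \<longrightarrow> F z = f z)) \<and>
     (\<exists>r > 0. \<exists>F. F holomorphic_on ball (complex_of_real y) r \<and>
        (\<forall>z \<in> ball (complex_of_real y) r. Im z < 0 \<longrightarrow> F z = f z))"

end

theory Submission
  imports Defs
begin

text \<open>The quotients \<open>P\<^sup>*\<^sub>n / P\<^sub>n\<close> converge off the real line because consecutive ones differ by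
  \<open>2 / (P\<^sub>n P\<^sub>n\<^sub>+\<^sub>1)\<close> and, by the Christoffel-Darboux identity for \<open>Im (P\<^sub>n\<^sub>+\<^sub>1 cnj P\<^sub>n)\<close>, the
  denominators grow geometrically. Periodicity of the coefficients makes the limit \<open>\<phi> / 2\<close> a
  fixed point of the monodromy matrix; the same identity, summed over one period of the
  corresponding solution, shows that its multiplier \<open>\<lambda>\<close> satisfies \<open>\<bar>\<lambda>\<bar> < 1\<close>. Since
  \<open>\<lambda>\<^sup>2 - 2 g \<lambda> + 1 = 0\<close>, only the sign in \<open>\<lambda> = g \<mp> s\<close> remains, and it is fixed by following a ray
  to infinity. At a zero of \<open>P\<^sub>N\<^sub>-\<^sub>1\<close> the determinant of the monodromy matrix gives
  \<open>g = (P\<^sub>N + 1 / P\<^sub>N) / 2\<close>, and \<open>\<bar>g - s\<bar> < 1\<close> decides which root of \<open>g\<^sup>2 - 1\<close> is the limit of \<open>s\<close>.\<close>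

section \<open>Solutions of the three-term recurrence off the real line\<close>

text \<open>The index is shifted by one: \<open>jsol b z x y n\<close> is the value at \<open>n - 1\<close> of the solution of the
  three-term recurrence, so that \<open>jfst\<close> and \<open>jsnd\<close> are \<open>P\<^sub>n\<^sub>-\<^sub>1\<close> and \<open>P\<^sup>*\<^sub>n\<^sub>-\<^sub>1 / 2\<close>.\<close>

fun jsol :: "(nat \<Rightarrow> real) \<Rightarrow> complex \<Rightarrow> complex \<Rightarrow> complex \<Rightarrow> nat \<Rightarrow> complex" where
  "jsol b z x y 0 = x"
| "jsol b z x y (Suc 0) = y"
| "jsol b z x y (Suc (Suc n)) =
     (2 * z - complex_of_real (b n)) * jsol b z x y (Suc n) - jsol b z x y n"

abbreviation jfst :: "(nat \<Rightarrow> real) \<Rightarrow> complex \<Rightarrow> nat \<Rightarrow> complex" where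
  "jfst b z \<equiv> jsol b z 0 1"

abbreviation jsnd :: "(nat \<Rightarrow> real) \<Rightarrow> complex \<Rightarrow> nat \<Rightarrow> complex" where
  "jsnd b z \<equiv> jsol b z (-1) 0"

text \<open>The recurrence is linear in the start values; the minus sign compensates the start value
  -1 of \<open>jsnd\<close>.\<close>

lemma jsol_eq_combination: "jsol b z x y n = y * jfst b z n - x * jsnd b z n"
proof (induction n rule: induct_nat_012)
  case (ge2 n)
  show ?case
    unfolding jsol.simps ge2 by (simp add: algebra_simps)
qed simp_all

lemma jsol_add_period:
  assumes "\<And>n. b (n + N) = b n"
  shows "jsol b z x y (n + N) = jsol b z (jsol b z x y N) (jsol b z x y (Suc N)) n"
  by (induction n rule: induct_nat_012) (simp_all add: assms)

text \<open>Each step of the recurrence has determinant 1, so the Casoratian keeps its value -1 from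
  index 0.\<close>

lemma casoratian: "jfst b z (Suc n) * jsnd b z n - jfst b z n * jsnd b z (Suc n) = -1"
  by (induction n) (simp_all add: algebra_simps)

text \<open>Multiply the recurrence by the conjugate of entry \<open>n + 1\<close>: the real
  coefficient \<open>b n\<close> drops out of the imaginary part, and the term with entry
  \<open>n\<close> returns the previous imaginary part.\<close>

lemma Im_jsol_Suc:
  "Im (jsol b z x y (Suc n) * cnj (jsol b z x y n))
     = Im (y * cnj x) + 2 * Im z * (\<Sum>k = 1..n. (cmod (jsol b z x y k))\<^sup>2)"
proof (induction n)
  case (Suc n)
  let ?u = "jsol b z x y"
  have "Im (?u (Suc (Suc n)) * cnj (?u (Suc n)))
      = Im (?u (Suc n) * cnj (?u n)) + 2 * Im z * (cmod (?u (Suc n)))\<^sup>2"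
    unfolding cmod_power2 by (simp add: algebra_simps power2_eq_square)
  with Suc show ?case
    by (simp add: algebra_simps)
qed simp

lemma jfst_norm_sum_pos:
  assumes "n \<ge> 1"
  shows "(\<Sum>k = 1..n. (cmod (jfst b z k))\<^sup>2) \<ge> 1"
  using assms
proof (induction n rule: nat_induct_at_least)
  case (Suc n)
  then show ?case by (simp add: add_increasing2)
qed simp

lemma jfst_norm_mult_ge:
  "cmod (jfst b z (Suc n)) * cmod (jfst b z n)
     \<ge> 2 * \<bar>Im z\<bar> * (\<Sum>k = 1..n. (cmod (jfst b z k))\<^sup>2)"
proof -
  have "2 * \<bar>Im z\<bar> * (\<Sum>k = 1..n. (cmod (jfst b z k))\<^sup>2)
      = \<bar>Im (jfst b z (Suc n) * cnj (jfst b z n))\<bar>"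
    unfolding Im_jsol_Suc by (simp add: abs_mult sum_nonneg)
  also have "\<dots> \<le> cmod (jfst b z (Suc n) * cnj (jfst b z n))"
    by (rule abs_Im_le_cmod)
  finally show ?thesis by (simp add: norm_mult)
qed

text \<open>A zero would make the product in \<open>jfst_norm_mult_ge\<close> vanish, although the
  sum there is at least 1.\<close>

lemma jfst_nonzero:
  assumes "Im z \<noteq> 0" "n \<ge> 1"
  shows "jfst b z n \<noteq> 0"
proof
  assume "jfst b z n = 0"
  with jfst_norm_mult_ge[where b = b and z = z and n = n]
  have "2 * \<bar>Im z\<bar> * (\<Sum>k = 1..n. (cmod (jfst b z k))\<^sup>2) \<le> 0" by simp
  moreover have "2 * \<bar>Im z\<bar> * (\<Sum>k = 1..n. (cmod (jfst b z k))\<^sup>2) > 0"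
    using assms jfst_norm_sum_pos[where n = n and b = b and z = z] by (intro mult_pos_pos) auto
  ultimately show False by simp
qed

text \<open>The two new terms are at least twice the product of their moduli, and
  \<open>jfst_norm_mult_ge\<close> bounds that product below by the sum already present.\<close>

lemma jfst_norm_sum_growth:
  fixes b z
  defines "S \<equiv> \<lambda>n. \<Sum>k = 1..n. (cmod (jfst b z k))\<^sup>2"
  shows "S (Suc (Suc n)) \<ge> (1 + 4 * \<bar>Im z\<bar>) * S n"
proof -
  let ?p = "cmod (jfst b z (Suc n))" and ?q = "cmod (jfst b z (Suc (Suc n)))"
  have "4 * \<bar>Im z\<bar> * S n \<le> 4 * \<bar>Im z\<bar> * S (Suc n)"
    unfolding S_def by (intro mult_left_mono) auto
  also have "\<dots> \<le> 2 * (?q * ?p)"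
    using jfst_norm_mult_ge[where b = b and z = z and n = "Suc n"] unfolding S_def by linarith
  also have "\<dots> \<le> ?p\<^sup>2 + ?q\<^sup>2"
    using sum_squares_bound[of ?q ?p] by (simp add: algebra_simps)
  finally show ?thesis
    unfolding S_def by (simp add: algebra_simps)
qed

text \<open>The growth factor is gained over two indices, hence the square root in
  \<open>\<rho>\<close>; dividing by \<open>\<rho>\<close> lets both base cases follow from the sum
  being at least 1.\<close>

lemma jfst_norm_sum_ge_power:
  fixes b z
  defines "\<rho> \<equiv> sqrt (1 + 4 * \<bar>Im z\<bar>)"
  shows "(\<Sum>k = 1..Suc n. (cmod (jfst b z k))\<^sup>2) \<ge> \<rho> ^ n / \<rho>"
proof (induction n rule: induct_nat_012)
  case 0
  then show ?case by (simp add: \<rho>_def)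
next
  case 1
  have "\<rho> > 0" by (simp add: \<rho>_def add_pos_nonneg)
  then show ?case using jfst_norm_sum_pos[where n = "Suc (Suc 0)" and b = b and z = z] by simp
next
  case (ge2 n)
  have "\<rho> ^ Suc (Suc n) / \<rho> = (1 + 4 * \<bar>Im z\<bar>) * (\<rho> ^ n / \<rho>)"
  proof -
    have "\<rho> * \<rho> = 1 + 4 * \<bar>Im z\<bar>" by (simp add: \<rho>_def)
    then show ?thesis by (metis mult.assoc power_Suc times_divide_eq_right)
  qed
  also have "\<dots> \<le> (1 + 4 * \<bar>Im z\<bar>) * (\<Sum>k = 1..Suc n. (cmod (jfst b z k))\<^sup>2)"
    using ge2(1) by (intro mult_left_mono) auto
  also note jfst_norm_sum_growth
  finally show ?case .
qed

lemma jsnd_over_jfst_convergent: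
  assumes "Im z \<noteq> 0"
  shows "convergent (\<lambda>n. jsnd b z (Suc n) / jfst b z (Suc n))"
proof -
  let ?A = "jfst b z" and ?B = "jsnd b z"
  define f where "f n = ?B (Suc n) / ?A (Suc n)" for n
  define \<rho> where "\<rho> = sqrt (1 + 4 * \<bar>Im z\<bar>)"
  have \<rho>: "\<rho> > 1" using assms by (simp add: \<rho>_def)
  have nz: "?A (Suc n) \<noteq> 0" for n by (rule jfst_nonzero[OF assms]) simp
  \<comment> \<open>Over the common denominator the numerator is minus the Casoratian at index
    \<open>n + 1\<close>.\<close>
  have step: "f (Suc n) - f n = 1 / (?A (Suc (Suc n)) * ?A (Suc n))" for n
    using casoratian[where b = b and z = z and n = "Suc n"] nz[of n] nz[of "Suc n"]
    unfolding f_def by (simp add: divide_simps del: jsol.simps) (simp add: algebra_simps del: jsol.simps)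
  have bound: "norm (f (Suc n) - f n) \<le> \<rho> / (2 * \<bar>Im z\<bar>) * (1 / \<rho>) ^ n" for n
  proof -
    have "2 * \<bar>Im z\<bar> * (\<rho> ^ n / \<rho>) \<le> 2 * \<bar>Im z\<bar> * (\<Sum>k = 1..Suc n. (cmod (?A k))\<^sup>2)"
      unfolding \<rho>_def by (intro mult_left_mono jfst_norm_sum_ge_power) auto
    also have "\<dots> \<le> cmod (?A (Suc (Suc n))) * cmod (?A (Suc n))"
      by (rule jfst_norm_mult_ge)
    finally have "1 / (cmod (?A (Suc (Suc n))) * cmod (?A (Suc n))) \<le> 1 / (2 * \<bar>Im z\<bar> * (\<rho> ^ n / \<rho>))"
      using \<rho> assms by (intro divide_left_mono mult_pos_pos) (auto simp del: jsol.simps simp: nz)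
    then show ?thesis
      using \<rho> assms by (simp add: step norm_divide norm_mult power_divide del: jsol.simps)
  qed
  have "summable (\<lambda>n. f (Suc n) - f n)"
  proof (rule summable_comparison_test')
    show "summable (\<lambda>n. \<rho> / (2 * \<bar>Im z\<bar>) * (1 / \<rho>) ^ n)"
      using \<rho> by (intro summable_mult summable_geometric) auto
  qed (use bound in auto)
  then have "convergent (\<lambda>n. \<Sum>k<n. f (Suc k) - f k)"
    by (simp add: summable_iff_convergent)
  then have "convergent (\<lambda>n. f n - f 0)"
    by (simp add: sum_lessThan_telescope)
  then have "convergent f"
    by (simp add: convergent_diff_const_right_iff)
  then show ?thesis by (simp add: f_def[abs_def])
qed

section \<open>Monodromy over one period and its multiplier\<close>

text \<open>\<open>m\<close> is the Weyl coefficient, later instantiated with half of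
  \<open>phi\<close>. The product form of \<open>herglotz\<close> treats both half-planes at
  once.\<close>

locale periodic_weyl =
  fixes b :: "nat \<Rightarrow> real" and N :: nat and z m :: complex
  assumes periodic: "\<And>n. b (n + N) = b n"
    and N_pos: "N \<ge> 1"
    and nonreal: "Im z \<noteq> 0"
    and lim: "(\<lambda>n. jsnd b z (Suc n) / jfst b z (Suc n)) \<longlonglongrightarrow> m"
    and herglotz: "Im z * Im m \<le> 0"
begin

text \<open>This is the Floquet multiplier of the solution \<open>jsnd - m * jfst\<close>: that
  solution is -1 at index 0 and \<open>- multiplier\<close> at index \<open>N\<close>.\<close>

definition multiplier :: complex where "multiplier = jfst b z N * m - jsnd b z N"

lemma jfst_add_period:
  "jfst b z (n + N) = jfst b z (Suc N) * jfst b z n - jfst b z N * jsnd b z n"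
  unfolding jsol_add_period[where b = b and N = N, OF periodic] by (subst jsol_eq_combination) simp

lemma jsnd_add_period:
  "jsnd b z (n + N) = jsnd b z (Suc N) * jfst b z n - jsnd b z N * jsnd b z n"
  unfolding jsol_add_period[where b = b and N = N, OF periodic] by (subst jsol_eq_combination) simp

text \<open>By periodicity the quotient at \<open>n + N\<close> is a fixed Moebius image of the
  quotient at \<open>n\<close>, and both tend to \<open>m\<close>. The limit is taken after clearing
  denominators, so the limiting denominator need not be known to be nonzero.\<close>

lemma fixed_point:
  "m * (jfst b z (Suc N) - jfst b z N * m) = jsnd b z (Suc N) - jsnd b z N * m"
proof -
  define f where "f n = jsnd b z (Suc n) / jfst b z (Suc n)" for n
  have f: "f \<longlonglongrightarrow> m" using lim by (simp add: f_def[abs_def])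
  have nz: "jfst b z (Suc n) \<noteq> 0" for n by (rule jfst_nonzero[OF nonreal]) simp
  have "f (n + N) * (jfst b z (Suc N) - jfst b z N * f n) = jsnd b z (Suc N) - jsnd b z N * f n" for n
  proof -
    have snd: "jsnd b z (Suc (n + N)) = jfst b z (Suc n) * (jsnd b z (Suc N) - jsnd b z N * f n)"
      using jsnd_add_period[of "Suc n"] nz[of n]
      by (simp add: f_def algebra_simps del: jsol.simps)
    have fst: "jfst b z (Suc (n + N)) = jfst b z (Suc n) * (jfst b z (Suc N) - jfst b z N * f n)"
      using jfst_add_period[of "Suc n"] nz[of n]
      by (simp add: f_def algebra_simps del: jsol.simps)
    have "jfst b z (Suc N) - jfst b z N * f n \<noteq> 0"
      using fst nz[of "n + N"] by auto
    then show ?thesis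
      unfolding f_def[of "n + N"] fst snd using nz[of n] by (simp del: jsol.simps)
  qed
  moreover have "(\<lambda>n. f (n + N) * (jfst b z (Suc N) - jfst b z N * f n))
      \<longlonglongrightarrow> m * (jfst b z (Suc N) - jfst b z N * m)"
    by (intro tendsto_intros f LIMSEQ_ignore_initial_segment)
  moreover have "(\<lambda>n. jsnd b z (Suc N) - jsnd b z N * f n) \<longlonglongrightarrow> jsnd b z (Suc N) - jsnd b z N * m"
    by (intro tendsto_intros f)
  ultimately show ?thesis
    using LIMSEQ_unique by auto
qed

text \<open>This is the characteristic equation of the monodromy matrix, whose trace is
  \<open>jfst b z (Suc N) - jsnd b z N\<close> and whose determinant is 1 by
  \<open>casoratian\<close>.\<close>

lemma multiplier_eq: "multiplier * (jfst b z (Suc N) - jsnd b z N - multiplier) = 1"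
proof -
  have "multiplier * (jfst b z (Suc N) - jsnd b z N - multiplier)
      = jfst b z N * (m * (jfst b z (Suc N) - jfst b z N * m))
        - jsnd b z N * (jfst b z (Suc N) - jfst b z N * m)"
    unfolding multiplier_def by (simp add: algebra_simps del: jsol.simps)
  also have "\<dots> = 1"
    unfolding fixed_point using casoratian[where b = b and z = z and n = N] by (simp add: algebra_simps del: jsol.simps)
  finally show ?thesis .
qed

text \<open>If the modulus were at least 1, the summed identity times \<open>Im z\<close> would
  equate a nonnegative sum with a nonpositive number. So \<open>u\<close> would vanish on
  \<open>1..N\<close>, while \<open>u N\<close> is the nonzero multiplier times
  \<open>u 0 = -1\<close>.\<close>

lemma norm_multiplier_less_1: "cmod multiplier < 1"
proof (rule ccontr)
  assume "\<not> cmod multiplier < 1"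
  then have ge: "(cmod multiplier)\<^sup>2 \<ge> 1" by simp
  define u where "u = jsol b z (-1) (-m)"
  have u: "u n = jsnd b z n - m * jfst b z n" for n
    unfolding u_def by (subst jsol_eq_combination) simp
  have uN: "u N = multiplier * u 0" "u (Suc N) = multiplier * u (Suc 0)"
    using fixed_point unfolding u multiplier_def by (simp_all add: algebra_simps)
  \<comment> \<open>The start values -1 and \<open>-m\<close> give \<open>u 1 * cnj (u 0)\<close>
    the imaginary part \<open>Im m\<close>; both factors pick up the multiplier over a
    period.\<close>
  have "(cmod multiplier)\<^sup>2 * Im m = Im (u (Suc N) * cnj (u N))"
    unfolding uN cmod_power2 by (simp add: u_def algebra_simps power2_eq_square)
  also have "\<dots> = Im m + 2 * Im z * (\<Sum>k = 1..N. (cmod (u k))\<^sup>2)"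
    unfolding u_def Im_jsol_Suc by simp
  finally have "((cmod multiplier)\<^sup>2 - 1) * Im m = 2 * Im z * (\<Sum>k = 1..N. (cmod (u k))\<^sup>2)"
    by (simp add: left_diff_distrib)
  then have "2 * (Im z)\<^sup>2 * (\<Sum>k = 1..N. (cmod (u k))\<^sup>2) = ((cmod multiplier)\<^sup>2 - 1) * (Im z * Im m)"
    by (metis mult.assoc mult.left_commute power2_eq_square)
  also have "\<dots> \<le> 0" using ge herglotz by (simp add: mult_nonneg_nonpos)
  finally have "(\<Sum>k = 1..N. (cmod (u k))\<^sup>2) \<le> 0"
    using nonreal by (simp add: mult_le_0_iff)
  then have "(\<Sum>k = 1..N. (cmod (u k))\<^sup>2) = 0"
    by (intro antisym sum_nonneg) auto
  then have "u k = 0" if "k \<in> {1..N}" for k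
    using that by (subst (asm) sum_nonneg_eq_0_iff) auto
  then have "u (Suc 0) = 0" "u N = 0" using N_pos by auto
  moreover have "multiplier \<noteq> 0" using ge by auto
  ultimately show False
    using uN by (simp add: u_def)
qed

end

section \<open>Real polynomials at complex points\<close>

lemma cpoly_diff: "cpoly (p - q) z = cpoly p z - cpoly q z"
proof -
  have "map_poly complex_of_real (p - q) = map_poly complex_of_real p - map_poly complex_of_real q"
    by (rule poly_eqI) (simp add: coeff_map_poly)
  then show ?thesis by simp
qed

lemma cpoly_add: "cpoly (p + q) z = cpoly p z + cpoly q z"
proof -
  have "map_poly complex_of_real (p + q) = map_poly complex_of_real p + map_poly complex_of_real q"
    by (rule poly_eqI) (simp add: coeff_map_poly)
  then show ?thesis by simp
qed

lemma cpoly_smult: "cpoly (smult c p) z = complex_of_real c * cpoly p z"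
  by (simp add: map_poly_smult)

lemma cpoly_pCons: "cpoly (pCons c p) z = complex_of_real c + z * cpoly p z"
  by (simp add: map_poly_pCons)

lemma cpoly_mult: "cpoly (p * q) z = cpoly p z * cpoly q z"
proof (induction p)
  case (pCons c p)
  then show ?case
    by (simp add: cpoly_add cpoly_smult cpoly_pCons algebra_simps)
qed simp

lemma cpoly_1: "cpoly 1 z = 1"
  by simp

lemma cpoly_numeral: "cpoly (numeral n) z = numeral n"
  by (simp add: numeral_poly map_poly_pCons)

lemma cpoly_prod: "cpoly (\<Prod>i\<in>I. p i) z = (\<Prod>i\<in>I. cpoly (p i) z)"
  by (induction I rule: infinite_finite_induct) (simp_all add: cpoly_mult)

lemma cpoly_of_real: "cpoly p (complex_of_real x) = complex_of_real (poly p x)"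
  by (induction p) (simp_all add: cpoly_pCons)

lemmas cpoly_simps = cpoly_diff cpoly_add cpoly_smult cpoly_pCons cpoly_mult cpoly_1 cpoly_numeral

lemma cpoly_Ppoly: "cpoly (Ppoly a N n) z = jfst (alpha a N) z (Suc n)"
proof (induction n rule: induct_nat_012)
  case (ge2 n)
  show ?case
    unfolding Ppoly.simps cpoly_diff cpoly_mult ge2 by (simp add: cpoly_pCons algebra_simps)
\<comment> \<open>Since \<open>alpha a N 0 = 2 * a\<close>, the special first clause of
  \<open>Ppoly\<close> is the general recurrence with coefficient index 0.\<close>
qed (simp_all add: cpoly_pCons alpha_def)

lemma cpoly_Pstar: "cpoly (Pstar a N n) z = 2 * jsnd (alpha a N) z (Suc n)"
proof (induction n rule: induct_nat_012)
  case (ge2 n)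
  show ?case
    unfolding Pstar.simps cpoly_diff cpoly_mult ge2 by (simp add: cpoly_pCons algebra_simps)
qed (simp_all add: cpoly_numeral)

text \<open>Thus g_N is half the trace of the monodromy matrix. \<open>N \<ge> 1\<close> keeps the
  truncated subtraction in \<open>Pstar a N (N - 1)\<close> honest.\<close>

lemma cpoly_discr_poly:
  assumes "N \<ge> 1"
  shows "cpoly (discr_poly a N) z = (jfst (alpha a N) z (Suc N) - jsnd (alpha a N) z N) / 2"
  using assms unfolding discr_poly_def
  by (simp add: cpoly_simps cpoly_Ppoly cpoly_Pstar del: jsol.simps)

lemma alpha_periodic:
  assumes "N \<ge> 1"
  shows "alpha a N (n + N) = alpha a N n"
proof -
  have "2 * real (n + N) * pi / real N = 2 * real n * pi / real N + 2 * pi"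
    using assms by (simp add: field_simps)
  then show ?thesis
    unfolding alpha_def by (simp only: cos_periodic)
qed

section \<open>The continued fraction and its limit\<close>

text \<open>Built from the innermost level outwards: subtracting a tail keeps the denominator in the
  closed half-plane of \<open>z\<close>, and inversion reflects it into the opposite one.\<close>

lemma Im_cf_tail:
  "Im z * Im (cf_tail a N z j n) \<le> 0"
proof (induction n arbitrary: j)
  case (Suc n)
  define w where "w = 2 * z - complex_of_real (alpha a N j) - cf_tail a N z (Suc j) n"
  have "Im z * Im w = 2 * (Im z)\<^sup>2 - Im z * Im (cf_tail a N z (Suc j) n)"
    by (simp add: w_def algebra_simps power2_eq_square)
  also have "\<dots> \<ge> 0" using Suc[of "Suc j"] by (smt (verit) zero_le_power2)
  finally have "Im z * Im w \<ge> 0" .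
  moreover have "Im z * Im (1 / w) = - (Im z * Im w) / ((Re w)\<^sup>2 + (Im w)\<^sup>2)"
    by (simp add: Im_divide)
  ultimately have "Im z * Im (1 / w) \<le> 0"
    by (simp add: divide_nonneg_nonneg)
  then show ?case by (simp add: w_def)
qed simp

text \<open>A zero would give the tail imaginary part \<open>2 * Im z\<close>, of the sign excluded
  by \<open>Im_cf_tail\<close>.\<close>

lemma cf_denominator_nonzero:
  assumes "Im z \<noteq> 0"
  shows "2 * z - complex_of_real r - cf_tail a N z j n \<noteq> 0"
proof
  assume "2 * z - complex_of_real r - cf_tail a N z j n = 0"
  then have "Im z * Im (cf_tail a N z j n) = 2 * (Im z)\<^sup>2"
    by (simp add: complex_eq_iff power2_eq_square)
  moreover have "(Im z)\<^sup>2 > 0" using assms by simp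
  ultimately show False using Im_cf_tail[of z a N j n] by linarith
qed

text \<open>The start level \<open>j\<close> is arbitrary so that the induction can peel off the
  outer fraction: expanding by its denominator \<open>d - t\<close> performs one step of the
  recurrence. At \<open>j = 0\<close> the left side is the tail itself.\<close>

lemma cf_tail_moebius:
  fixes a N z
  defines "A \<equiv> jfst (alpha a N) z" and "B \<equiv> jsnd (alpha a N) z"
  assumes "Im z \<noteq> 0"
  shows "(B (Suc j) - B j * cf_tail a N z j n) / (A (Suc j) - A j * cf_tail a N z j n)
       = B (Suc (j + n)) / A (Suc (j + n))"
proof (induction n arbitrary: j)
  case (Suc n)
  define t where "t = cf_tail a N z (Suc j) n"
  define d where "d = 2 * z - complex_of_real (alpha a N j)"
  have d: "d - t \<noteq> 0"
    unfolding d_def t_def using assms(3) by (rule cf_denominator_nonzero)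
  have "(B (Suc j) - B j * (1 / (d - t))) / (A (Suc j) - A j * (1 / (d - t)))
      = ((d - t) * (B (Suc j) - B j * (1 / (d - t)))) / ((d - t) * (A (Suc j) - A j * (1 / (d - t))))"
    using d by simp
  also have "(d - t) * (B (Suc j) - B j * (1 / (d - t))) = B (Suc (Suc j)) - B (Suc j) * t"
    using d by (simp add: algebra_simps B_def d_def) (simp add: field_simps)
  also have "(d - t) * (A (Suc j) - A j * (1 / (d - t))) = A (Suc (Suc j)) - A (Suc j) * t"
    using d by (simp add: algebra_simps A_def d_def) (simp add: field_simps)
  also have "(B (Suc (Suc j)) - B (Suc j) * t) / (A (Suc (Suc j)) - A (Suc j) * t)
      = B (Suc (j + Suc n)) / A (Suc (j + Suc n))"
    unfolding t_def using Suc[of "Suc j"] by simp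
  finally show ?case by (simp add: d_def t_def)
qed simp

lemma cf_tail_eq:
  assumes "Im z \<noteq> 0"
  shows "cf_tail a N z 0 n = jsnd (alpha a N) z (Suc n) / jfst (alpha a N) z (Suc n)"
  using cf_tail_moebius[OF assms, of a N 0 n] by simp

lemma cf_convergent_eq: "cf_convergent a N z n = 2 * cf_tail a N z 0 (Suc n)"
  by (simp add: cf_convergent_def)

lemma tendsto_half_phi:
  assumes "Im z \<noteq> 0"
  shows "(\<lambda>n. jsnd (alpha a N) z (Suc n) / jfst (alpha a N) z (Suc n)) \<longlonglongrightarrow> phi a N z / 2"
    and "cf_convergent a N z \<longlonglongrightarrow> phi a N z"
proof -
  obtain m where m: "(\<lambda>n. jsnd (alpha a N) z (Suc n) / jfst (alpha a N) z (Suc n)) \<longlonglongrightarrow> m"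
    using jsnd_over_jfst_convergent[OF assms] unfolding convergent_def by blast
  then have "(\<lambda>n. cf_tail a N z 0 n) \<longlonglongrightarrow> m"
    by (simp add: cf_tail_eq[OF assms])
  then have "(\<lambda>n. 2 * cf_tail a N z 0 (Suc n)) \<longlonglongrightarrow> 2 * m"
    by (intro tendsto_mult tendsto_const LIMSEQ_Suc)
  then have *: "cf_convergent a N z \<longlonglongrightarrow> 2 * m"
    unfolding cf_convergent_eq[abs_def] .
  \<comment> \<open>\<open>phi\<close> is given by \<open>lim\<close>, whose value is known only
    once convergence has been shown.\<close>
  then have "phi a N z = 2 * m"
    unfolding phi_def by (rule limI)
  with m * show "(\<lambda>n. jsnd (alpha a N) z (Suc n) / jfst (alpha a N) z (Suc n)) \<longlonglongrightarrow> phi a N z / 2"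
    and "cf_convergent a N z \<longlonglongrightarrow> phi a N z"
    by simp_all
qed

lemma periodic_weyl_phi:
  assumes "N \<ge> 1" "Im z \<noteq> 0"
  shows "periodic_weyl (alpha a N) N z (phi a N z / 2)"
proof
  show lim: "(\<lambda>n. jsnd (alpha a N) z (Suc n) / jfst (alpha a N) z (Suc n)) \<longlonglongrightarrow> phi a N z / 2"
    using assms(2) by (rule tendsto_half_phi)
  have "(\<lambda>n. Im z * Im (cf_tail a N z 0 n)) \<longlonglongrightarrow> Im z * Im (phi a N z / 2)"
    using lim by (intro tendsto_intros) (simp add: cf_tail_eq[OF assms(2)])
  then show "Im z * Im (phi a N z / 2) \<le> 0"
    by (rule LIMSEQ_le_const2) (use Im_cf_tail in auto)
qed (use assms alpha_periodic in auto)

text \<open>Here \<open>l\<close> is the multiplier of the recessive Floquet solution.\<close>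

lemma phi_multiplier:
  fixes a N z
  defines "g \<equiv> cpoly (discr_poly a N) z"
  assumes "N \<ge> 1" "Im z \<noteq> 0"
  obtains l where "cmod l < 1" "l * (2 * g - l) = 1"
    "phi a N z = 2 * (cpoly (Ppoly a N N) z - 2 * g + l) / cpoly (Ppoly a N (N - 1)) z"
proof -
  interpret periodic_weyl "alpha a N" N z "phi a N z / 2"
    using assms(2,3) by (rule periodic_weyl_phi)
  have nz: "jfst (alpha a N) z N \<noteq> 0"
    using assms by (intro jfst_nonzero) auto
  have "multiplier * (2 * g - multiplier) = 1"
  proof -
    have "2 * g = jfst (alpha a N) z (Suc N) - jsnd (alpha a N) z N"
      using assms(2) by (simp add: g_def cpoly_discr_poly del: jsol.simps)
    then show ?thesis using multiplier_eq by (simp only:)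
  qed
  \<comment> \<open>Solve the definition of \<open>multiplier\<close> for \<open>m\<close> and
    replace \<open>jsnd\<close> at \<open>N\<close> by \<open>jfst\<close> at \<open>Suc N\<close>
    minus \<open>2 * g\<close>.\<close>
  moreover have "phi a N z = 2 * (cpoly (Ppoly a N N) z - 2 * g + multiplier) / cpoly (Ppoly a N (N - 1)) z"
    using nz assms(2)
    by (simp add: g_def cpoly_discr_poly multiplier_def cpoly_Ppoly field_simps del: jsol.simps)
  ultimately show ?thesis
    using norm_multiplier_less_1 that by blast
qed

section \<open>Degrees and factorisation of \<open>g^2 - 1\<close>\<close>

text \<open>The size hypothesis says that \<open>p\<close> splits; it is inherited by the cofactor
  of any linear factor, because degree and root count both drop by one.\<close>

lemma poly_eq_smult_prod_roots:
  fixes p :: "'a::idom poly"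
  assumes "size (proots p) = degree p"
  shows "p = smult (lead_coeff p) (\<Prod>x\<in>#proots p. [:-x, 1:])"
  using assms
proof (induction "degree p" arbitrary: p)
  case 0
  then obtain c where "p = [:c:]" by (metis degree_eq_zeroE)
  then show ?case by simp
next
  case (Suc n)
  then have "p \<noteq> 0" by auto
  from Suc have "proots p \<noteq> {#}" by auto
  then obtain x where "x \<in># proots p" by blast
  then have "poly p x = 0" using \<open>p \<noteq> 0\<close> by simp
  then obtain q where q: "p = [:-x, 1:] * q"
    by (metis dvdE poly_eq_0_iff_dvd)
  with \<open>p \<noteq> 0\<close> have "q \<noteq> 0" by auto
  have deg: "degree p = Suc (degree q)"
    unfolding q using \<open>q \<noteq> 0\<close> by (subst degree_mult_eq) auto
  have roots: "proots p = add_mset x (proots q)"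
    unfolding q using \<open>q \<noteq> 0\<close> by (subst proots_mult) auto
  have lc: "lead_coeff p = lead_coeff q"
    unfolding q by (subst lead_coeff_mult) simp
  have "q = smult (lead_coeff q) (\<Prod>x\<in>#proots q. [:-x, 1:])"
    using Suc deg roots by (intro Suc(1)) auto
  then have "p = [:-x, 1:] * smult (lead_coeff q) (\<Prod>x\<in>#proots q. [:-x, 1:])"
    using q by simp
  then show ?case
    unfolding roots lc by (simp add: mult_smult_right)
qed

lemma degree_Ppoly_aux: "degree (Ppoly a N n) \<le> n \<and> coeff (Ppoly a N n) n = 2 ^ n"
proof (induction n rule: induct_nat_012)
  case (ge2 n)
  let ?q = "[:- alpha a N (Suc n), 2:]"
  have "degree (?q * Ppoly a N (Suc n)) \<le> Suc (Suc n)"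
    using degree_mult_le[of ?q "Ppoly a N (Suc n)"] ge2 by simp
  then have "degree (Ppoly a N (Suc (Suc n))) \<le> Suc (Suc n)"
    using ge2 by (simp only: Ppoly.simps) (intro degree_diff_le, auto)
  moreover have "coeff (Ppoly a N n) (Suc (Suc n)) = 0" "coeff (Ppoly a N (Suc n)) (Suc (Suc n)) = 0"
    using ge2 by (auto intro!: coeff_eq_0)
  ultimately show ?case using ge2 by simp
qed auto

lemma degree_Ppoly: "degree (Ppoly a N n) = n"
  using degree_Ppoly_aux[of a N n] by (intro antisym le_degree) auto

lemma lead_coeff_Ppoly: "lead_coeff (Ppoly a N n) = 2 ^ n"
  using degree_Ppoly_aux[of a N n] by (simp add: degree_Ppoly)

lemma degree_Pstar: "degree (Pstar a N n) \<le> n - 1"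
proof (induction n rule: induct_nat_012)
  case (ge2 n)
  let ?q = "[:- alpha a N (Suc n), 2:]"
  have "degree (?q * Pstar a N (Suc n)) \<le> Suc n"
    using degree_mult_le[of ?q "Pstar a N (Suc n)"] ge2 by simp
  then show ?case
    using ge2 by (simp only: Pstar.simps) (intro degree_diff_le, auto)
qed auto

lemma discr_poly_degree:
  assumes "N \<ge> 1"
  shows "degree (discr_poly a N) = N" and "lead_coeff (discr_poly a N) = 2 ^ (N - 1)"
proof -
  have small: "degree (Pstar a N (N - 1)) < N"
    using degree_Pstar[of a N "N - 1"] assms by simp
  have c: "coeff (discr_poly a N) N = 2 ^ (N - 1)"
    using small assms degree_Ppoly_aux[of a N N] unfolding discr_poly_def
    by (simp add: coeff_eq_0 power_eq_if)
  have "degree (discr_poly a N) \<le> N"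
    using small degree_Ppoly[of a N N] unfolding discr_poly_def
    by (auto intro!: order.trans[OF degree_smult_le] degree_diff_le)
  with c show "degree (discr_poly a N) = N" by (intro antisym le_degree) auto
  with c show "lead_coeff (discr_poly a N) = 2 ^ (N - 1)" by simp
qed

lemma discr_poly_square_eq_prod:
  assumes "N \<ge> 1"
    and "proots ((discr_poly a N)\<^sup>2 - 1) = image_mset \<xi> (mset_set {1..2 * N})"
  shows "(discr_poly a N)\<^sup>2 - 1 = smult (4 ^ (N - 1)) (\<Prod>j = 1..2 * N. [:- \<xi> j, 1:])"
proof -
  let ?g = "discr_poly a N"
  have "?g \<noteq> 0" using discr_poly_degree(1)[OF assms(1), of a] assms(1) by auto
  then have deg: "degree (?g\<^sup>2) = 2 * N"
    using discr_poly_degree(1)[OF assms(1), of a] by (simp add: degree_power_eq)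
  have "lead_coeff (?g\<^sup>2) = (2 ^ (N - 1))\<^sup>2"
    by (simp only: lead_coeff_power discr_poly_degree(2)[OF assms(1)])
  also have "\<dots> = (4 :: real) ^ (N - 1)"
    by (simp add: power2_eq_square flip: power_mult_distrib)
  finally have lc: "lead_coeff (?g\<^sup>2) = 4 ^ (N - 1)" .
  have deg': "degree (?g\<^sup>2 - 1) = 2 * N"
    using deg assms(1) degree_add_eq_left[of "-1" "?g\<^sup>2"] by simp
  have lc': "lead_coeff (?g\<^sup>2 - 1) = 4 ^ (N - 1)"
    using deg lc assms(1) unfolding deg' by simp
  have "?g\<^sup>2 - 1 = smult (lead_coeff (?g\<^sup>2 - 1)) (\<Prod>x\<in>#proots (?g\<^sup>2 - 1). [:-x, 1:])"
    by (rule poly_eq_smult_prod_roots) (simp only: deg', simp add: assms(2))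
  then show ?thesis
    unfolding lc' assms(2) by (simp add: prod_unfold_prod_mset image_mset.compositionality comp_def)
qed

text \<open>\<open>csqrt\<close> squares back to its argument at every point, cut included, so the
  identity holds on the whole plane; the branch affects only the sign.\<close>

lemma sqrt_branch_square:
  assumes "N \<ge> 1"
    and "proots ((discr_poly a N)\<^sup>2 - 1) = image_mset \<xi> (mset_set {1..2 * N})"
  shows "(sqrt_branch N \<xi> z)\<^sup>2 = (cpoly (discr_poly a N) z)\<^sup>2 - 1"
proof -
  have "(cpoly (discr_poly a N) z)\<^sup>2 - 1 = cpoly ((discr_poly a N)\<^sup>2 - 1) z"
    by (simp add: cpoly_simps power2_eq_square)
  also have "\<dots> = 4 ^ (N - 1) * (\<Prod>j = 1..2 * N. z - complex_of_real (\<xi> j))"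
    unfolding discr_poly_square_eq_prod[OF assms] by (simp add: cpoly_smult cpoly_prod cpoly_pCons)
  also have "\<dots> = (sqrt_branch N \<xi> z)\<^sup>2"
    unfolding sqrt_branch_def by (simp add: power_mult_distrib prod_power_distrib power_mult[symmetric] mult.commute[of _ 2])
       (simp add: power_mult)
  finally show ?thesis ..
qed

section \<open>Choosing the branch of the square root\<close>

lemma csqrt_of_real_mult:
  assumes "t \<ge> 0"
  shows "csqrt (complex_of_real t * w) = complex_of_real (sqrt t) * csqrt w"
proof (cases "t = 0")
  case False
  with assms have t: "sqrt t > 0" by simp
  show ?thesis
  proof (rule csqrt_unique)
    show "(complex_of_real (sqrt t) * csqrt w)\<^sup>2 = complex_of_real t * w"
      using assms by (simp add: power_mult_distrib flip: of_real_power)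
    show "0 < Re (complex_of_real (sqrt t) * csqrt w) \<or>
        Re (complex_of_real (sqrt t) * csqrt w) = 0 \<and> 0 \<le> Im (complex_of_real (sqrt t) * csqrt w)"
      using t csqrt_principal[of w] by (auto simp: zero_less_mult_iff)
  qed
qed simp

lemma tendsto_inverse_of_real_at_top: "((\<lambda>t. inverse (complex_of_real t)) \<longlongrightarrow> 0) at_top"
proof -
  have "((\<lambda>t. complex_of_real (inverse t)) \<longlongrightarrow> complex_of_real 0) at_top"
    by (intro tendsto_of_real tendsto_inverse_0_at_top filterlim_ident)
  then show ?thesis by simp
qed

text \<open>The constant coefficient is split off and dies in the limit. A bound on the degree,
  instead of equality, passes to the quotient even when that is 0.\<close>

lemma cpoly_tendsto_ray:
  assumes "degree p \<le> n"
  shows "((\<lambda>t. cpoly p (complex_of_real t * z) / complex_of_real t ^ n)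
           \<longlongrightarrow> complex_of_real (coeff p n) * z ^ n) at_top"
  using assms
proof (induction n arbitrary: p)
  case 0
  then obtain c where "p = [:c:]" by (metis le_zero_eq degree_eq_zeroE)
  then show ?case by (simp add: cpoly_pCons)
next
  case (Suc n)
  obtain c q where p: "p = pCons c q" by (cases p)
  have "degree q \<le> n" using Suc.prems unfolding p by (cases "q = 0") auto
  have "((\<lambda>t. complex_of_real c * inverse (complex_of_real t) ^ Suc n
            + z * (cpoly q (complex_of_real t * z) / complex_of_real t ^ n))
          \<longlongrightarrow> complex_of_real c * 0 ^ Suc n + z * (complex_of_real (coeff q n) * z ^ n)) at_top"
    by (intro tendsto_intros tendsto_inverse_of_real_at_top Suc.IH \<open>degree q \<le> n\<close>)
  then have lim: "((\<lambda>t. complex_of_real c * inverse (complex_of_real t) ^ Suc n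
            + z * (cpoly q (complex_of_real t * z) / complex_of_real t ^ n))
          \<longlongrightarrow> complex_of_real (coeff p (Suc n)) * z ^ Suc n) at_top"
    by (simp add: p mult_ac)
  show ?case
    by (rule Lim_transform_eventually[OF lim])
       (use eventually_gt_at_top[of 0] in eventually_elim, simp add: p cpoly_pCons field_simps)
qed

lemma nonreal_minus_real_notin_nonpos:
  assumes "Im z \<noteq> 0"
  shows "z - complex_of_real x \<notin> \<real>\<^sub>\<le>\<^sub>0"
  using assms by (auto simp: complex_nonpos_Reals_iff)

text \<open>Each of the \<open>2 * N\<close> factors releases \<open>sqrt t\<close>, together
  \<open>t ^ N\<close>; what remains tends to \<open>csqrt z\<close>, where \<open>csqrt\<close> is
  continuous. The plus sign of the limit is what later decides the branch.\<close>

lemma sqrt_branch_tendsto_ray: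
  assumes "Im z \<noteq> 0"
  shows "((\<lambda>t. sqrt_branch N \<xi> (complex_of_real t * z) / complex_of_real t ^ N)
           \<longlongrightarrow> 2 ^ (N - 1) * z ^ N) at_top"
proof -
  have inv: "((\<lambda>t. complex_of_real (\<xi> j) * inverse (complex_of_real t)) \<longlongrightarrow> 0) at_top" for j
    using tendsto_mult_left[OF tendsto_inverse_of_real_at_top, of "complex_of_real (\<xi> j)"] by simp
  have fac: "((\<lambda>t. csqrt (z - complex_of_real (\<xi> j) * inverse (complex_of_real t))) \<longlongrightarrow> csqrt z) at_top" for j
  proof (rule isCont_tendsto_compose[where g = csqrt])
    show "isCont csqrt z"
      using nonreal_minus_real_notin_nonpos[OF assms, of 0] by (intro continuous_at_csqrt) simp
    show "((\<lambda>t. z - complex_of_real (\<xi> j) * inverse (complex_of_real t)) \<longlongrightarrow> z) at_top"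
      using tendsto_diff[OF tendsto_const inv, of z] by simp
  qed
  have "((\<lambda>t. 2 ^ (N - 1) * (\<Prod>j = 1..2 * N. csqrt (z - complex_of_real (\<xi> j) * inverse (complex_of_real t))))
          \<longlongrightarrow> 2 ^ (N - 1) * (\<Prod>j = 1..2 * N. csqrt z)) at_top"
    by (intro tendsto_intros fac)
  then have lim: "((\<lambda>t. 2 ^ (N - 1) * (\<Prod>j = 1..2 * N. csqrt (z - complex_of_real (\<xi> j) * inverse (complex_of_real t))))
          \<longlongrightarrow> 2 ^ (N - 1) * z ^ N) at_top"
    by (simp add: power_mult)
  have "eventually (\<lambda>t. 2 ^ (N - 1) * (\<Prod>j = 1..2 * N. csqrt (z - complex_of_real (\<xi> j) * inverse (complex_of_real t)))
      = sqrt_branch N \<xi> (complex_of_real t * z) / complex_of_real t ^ N) at_top"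
    using eventually_gt_at_top[of 0]
  proof eventually_elim
    case (elim t)
    have "csqrt (complex_of_real t * z - complex_of_real (\<xi> j))
        = complex_of_real (sqrt t) * csqrt (z - complex_of_real (\<xi> j) * inverse (complex_of_real t))" for j
      using elim by (subst csqrt_of_real_mult[symmetric]) (auto simp: right_diff_distrib mult.left_commute[of "complex_of_real t" "complex_of_real (\<xi> j)"])
    then have "sqrt_branch N \<xi> (complex_of_real t * z) = complex_of_real (sqrt t) ^ (2 * N) *
        (2 ^ (N - 1) * (\<Prod>j = 1..2 * N. csqrt (z - complex_of_real (\<xi> j) * inverse (complex_of_real t))))"
      unfolding sqrt_branch_def by (simp add: prod.distrib)
    also have "complex_of_real (sqrt t) ^ (2 * N) = complex_of_real t ^ N"
      using elim by (simp add: power_mult flip: of_real_power)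
    finally show ?case using elim by simp
  qed
  with lim show ?thesis by (rule Lim_transform_eventually)
qed

text \<open>Along the ray through \<open>z\<close> the modulus of \<open>g - s\<close> is never \<open>1\<close>, since \<open>g - s\<close> is the
  multiplier or its inverse, and it tends to \<open>0\<close> at infinity because
  \<open>(g - s) (g + s) = 1\<close> and \<open>g + s\<close> grows like \<open>2 ^ N z ^ N\<close>.\<close>

lemma norm_discr_minus_sqrt_less_1:
  assumes "N \<ge> 1" "Im z \<noteq> 0"
    and roots: "proots ((discr_poly a N)\<^sup>2 - 1) = image_mset \<xi> (mset_set {1..2 * N})"
  shows "cmod (cpoly (discr_poly a N) z - sqrt_branch N \<xi> z) < 1"
proof (rule ccontr)
  define g where "g = cpoly (discr_poly a N)"
  define s where "s = sqrt_branch N \<xi>"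
  define h where "h t = cmod (g (complex_of_real t * z) - s (complex_of_real t * z))" for t
  have prod1: "(g w - s w) * (g w + s w) = 1" for w
    using sqrt_branch_square[OF assms(1) roots, of w] unfolding g_def s_def
    by (simp add: algebra_simps power2_eq_square)
  have ne1: "cmod (g w - s w) \<noteq> 1" if w: "Im w \<noteq> 0" for w
  proof -
    obtain l where l: "cmod l < 1" "l * (2 * g w - l) = 1"
      using phi_multiplier[OF assms(1) w] unfolding g_def by metis
    have "(l - (g w - s w)) * (l - (g w + s w)) = 0"
      using l(2) prod1[of w] by (simp add: algebra_simps)
    then have "l = g w - s w \<or> l = g w + s w" by auto
    then show ?thesis
    proof
      assume "l = g w + s w"
      then have "cmod (g w - s w) * cmod l = 1"
        using prod1[of w] by (metis norm_mult norm_one)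
      then show ?thesis using l(1) by auto
    qed (use l in auto)
  qed
  assume "\<not> ?thesis"
  then have h1: "h 1 \<ge> 1" by (simp add: h_def g_def s_def)
  have "((\<lambda>t. g (complex_of_real t * z) / complex_of_real t ^ N + s (complex_of_real t * z) / complex_of_real t ^ N)
      \<longlongrightarrow> complex_of_real (coeff (discr_poly a N) N) * z ^ N + 2 ^ (N - 1) * z ^ N) at_top"
    unfolding g_def s_def
    by (intro tendsto_add cpoly_tendsto_ray sqrt_branch_tendsto_ray assms)
       (simp add: discr_poly_degree[OF assms(1)])
  moreover have "coeff (discr_poly a N) N = 2 ^ (N - 1)"
    using discr_poly_degree[OF assms(1), of a] by simp
  ultimately have "((\<lambda>t. (g (complex_of_real t * z) + s (complex_of_real t * z)) / complex_of_real t ^ N)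
      \<longlongrightarrow> 2 * (2 ^ (N - 1) * z ^ N)) at_top"
    by (simp add: add_divide_distrib mult_ac)
  then have lim: "((\<lambda>t. cmod ((g (complex_of_real t * z) + s (complex_of_real t * z)) / complex_of_real t ^ N))
      \<longlongrightarrow> cmod (2 * (2 ^ (N - 1) * z ^ N))) at_top"
    by (rule tendsto_norm)
  have "filterlim (\<lambda>t. cmod ((g (complex_of_real t * z) + s (complex_of_real t * z)) / complex_of_real t ^ N) * t ^ N)
      at_top at_top"
  proof (rule filterlim_tendsto_pos_mult_at_top[OF lim])
    show "0 < cmod (2 * (2 ^ (N - 1) * z ^ N))" using assms(2) by auto
    show "filterlim (\<lambda>t::real. t ^ N) at_top at_top"
      using assms(1) by (intro filterlim_pow_at_top filterlim_ident) auto
  qed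
  then have "eventually (\<lambda>t. cmod ((g (complex_of_real t * z) + s (complex_of_real t * z)) / complex_of_real t ^ N) * t ^ N > 1) at_top"
    by (simp add: filterlim_at_top_dense)
  then have "eventually (\<lambda>t. h t < 1 \<and> t \<ge> 1) at_top"
    using eventually_ge_at_top[of 1]
  proof eventually_elim
    case (elim t)
    then have "1 < cmod (g (complex_of_real t * z) + s (complex_of_real t * z))"
      by (simp add: norm_divide norm_power)
    moreover have "h t * cmod (g (complex_of_real t * z) + s (complex_of_real t * z)) = 1"
      unfolding h_def by (metis norm_mult norm_one prod1)
    moreover have "h t \<ge> 0" by (simp add: h_def)
    ultimately have "h t < 1" by (smt (verit) mult_le_cancel_right1)
    with elim show ?case by simp
  qed
  then obtain T where T: "h T < 1" "T \<ge> 1"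
    using eventually_happens'[OF trivial_limit_at_top_linorder] by blast
  have "continuous_on {1..T} h"
    unfolding h_def g_def s_def sqrt_branch_def
  proof (intro continuous_intros continuous_on_compose2[OF continuous_on_csqrt] subsetI)
    fix w j assume "w \<in> (\<lambda>t. complex_of_real t * z - complex_of_real (\<xi> j)) ` {1..T}"
    then obtain t where "t \<ge> 1" "w = complex_of_real t * z - complex_of_real (\<xi> j)" by auto
    then show "w \<in> - \<real>\<^sub>\<le>\<^sub>0"
      using nonreal_minus_real_notin_nonpos[of "complex_of_real t * z" "\<xi> j"] assms(2) by simp
  qed
  \<comment> \<open>From \<open>h 1 \<ge> 1\<close> and \<open>h T < 1\<close> the value 1 is
    attained on the ray, against \<open>ne1\<close>.\<close>
  then obtain t where "1 \<le> t" "t \<le> T" "h t = 1"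
    using IVT2'[of h T 1 1] T h1 by auto
  then show False
    using ne1[of "complex_of_real t * z"] assms(2) by (simp add: h_def)
qed

text \<open>The multiplier is \<open>g - s\<close> or \<open>g + s\<close>, two numbers with product
  1. As \<open>g - s\<close> already lies in the open unit disc, \<open>g + s\<close> lies outside
  it.\<close>

lemma phi_eq:
  assumes "N \<ge> 1" "Im z \<noteq> 0"
    and roots: "proots ((discr_poly a N)\<^sup>2 - 1) = image_mset \<xi> (mset_set {1..2 * N})"
  shows "phi a N z = 2 * (cpoly (Ppoly a N N) z - cpoly (discr_poly a N) z - sqrt_branch N \<xi> z)
                       / cpoly (Ppoly a N (N - 1)) z"
proof -
  define g where "g = cpoly (discr_poly a N) z"
  define s where "s = sqrt_branch N \<xi> z"
  obtain l where l: "cmod l < 1" "l * (2 * g - l) = 1"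
    "phi a N z = 2 * (cpoly (Ppoly a N N) z - 2 * g + l) / cpoly (Ppoly a N (N - 1)) z"
    using phi_multiplier[OF assms(1,2)] unfolding g_def by metis
  have less: "cmod (g - s) < 1"
    unfolding g_def s_def by (rule norm_discr_minus_sqrt_less_1[OF assms])
  have prod1: "(g - s) * (g + s) = 1"
    using sqrt_branch_square[OF assms(1) roots, of z] unfolding g_def s_def
    by (simp add: algebra_simps power2_eq_square)
  have "(l - (g - s)) * (l - (g + s)) = 0"
    using l(2) prod1 by (simp add: algebra_simps)
  moreover have "l \<noteq> g + s"
  proof
    assume "l = g + s"
    then have "cmod (g - s) * cmod l = 1" using prod1 by (metis norm_mult norm_one)
    moreover have "cmod (g - s) * cmod l < 1 * 1"
      using less l(1) by (intro mult_strict_mono') auto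
    ultimately show False by simp
  qed
  ultimately have "l = g - s" by simp
  then show ?thesis using l(3) unfolding g_def s_def by simp
qed

text \<open>No continuity of the branch is needed: the limits \<open>\<plusminus> s\<close> of the square roots of
  \<open>g\<^sup>2 - 1\<close> are told apart by the condition that \<open>g - s\<close> lies in the closed unit disc.\<close>

lemma tendsto_sqrt_of_norm_less_1:
  fixes G S :: "'a \<Rightarrow> complex" and g :: real
  assumes G: "(G \<longlongrightarrow> complex_of_real g) F" and g: "\<bar>g\<bar> \<ge> 1"
    and sq: "eventually (\<lambda>x. (S x)\<^sup>2 = (G x)\<^sup>2 - 1) F"
    and less: "eventually (\<lambda>x. cmod (G x - S x) < 1) F"
  shows "(S \<longlongrightarrow> complex_of_real (sgn g * sqrt (g\<^sup>2 - 1))) F"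
proof -
  define s where "s = sgn g * sqrt (g\<^sup>2 - 1)"
  have g2: "g\<^sup>2 \<ge> 1" using g by (metis abs_le_square_iff abs_one one_power2)
  have s2: "s\<^sup>2 = g\<^sup>2 - 1"
    using g g2 by (auto simp: s_def power_mult_distrib sgn_if)
  have "((\<lambda>x. (G x)\<^sup>2 - 1) \<longlongrightarrow> (complex_of_real g)\<^sup>2 - 1) F"
    by (intro tendsto_intros G)
  moreover have "(complex_of_real g)\<^sup>2 - 1 = (complex_of_real s)\<^sup>2"
    using s2 by (metis of_real_1 of_real_diff of_real_power)
  ultimately have "((\<lambda>x. (G x)\<^sup>2 - 1) \<longlongrightarrow> (complex_of_real s)\<^sup>2) F" by simp
  then have S2: "((\<lambda>x. (S x)\<^sup>2) \<longlongrightarrow> (complex_of_real s)\<^sup>2) F"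
    by (rule Lim_transform_eventually) (use sq in \<open>eventually_elim, simp\<close>)
  have "(S \<longlongrightarrow> complex_of_real s) F"
  proof (cases "s = 0")
    case True
    with S2 have "((\<lambda>x. cmod ((S x)\<^sup>2)) \<longlongrightarrow> 0) F"
      by (simp add: tendsto_norm_zero)
    then have "((\<lambda>x. sqrt (cmod ((S x)\<^sup>2))) \<longlongrightarrow> sqrt 0) F"
      by (rule tendsto_real_sqrt)
    then have "((\<lambda>x. cmod (S x)) \<longlongrightarrow> 0) F"
      by (simp add: norm_power)
    then show ?thesis using True by (simp add: tendsto_norm_zero_cancel)
  next
    case False
    have gs: "\<bar>g + s\<bar> = \<bar>g\<bar> + \<bar>s\<bar>"
    proof -
      define q where "q = sqrt (g\<^sup>2 - 1)"
      have "q \<ge> 0" using g2 by (simp add: q_def)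
      then show ?thesis unfolding s_def q_def[symmetric] by (auto simp: sgn_if)
    qed
    \<comment> \<open>\<open>c\<close> is the margin by which \<open>g + s\<close> lies outside the
      unit disc. \<open>S x\<close> near \<open>-s\<close> would put \<open>G x - S x\<close> near
      \<open>g + s\<close>, which \<open>less\<close> forbids; hence \<open>S x + s\<close> stays at
      distance at least \<open>c / 2\<close> from 0.\<close>
    define c where "c = \<bar>g\<bar> + \<bar>s\<bar> - 1"
    have c: "c > 0" using False g by (simp add: c_def)
    have "((\<lambda>x. (S x)\<^sup>2 - (complex_of_real s)\<^sup>2) \<longlongrightarrow> 0) F"
      using tendsto_diff[OF S2 tendsto_const, of "(complex_of_real s)\<^sup>2"] by simp
    then have lim0: "((\<lambda>x. 2 / c * cmod ((S x)\<^sup>2 - (complex_of_real s)\<^sup>2)) \<longlongrightarrow> 0) F"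
      by (intro tendsto_mult_right_zero tendsto_norm_zero)
    have "eventually (\<lambda>x. dist (G x) (complex_of_real g) < c / 2) F"
      using G c by (intro tendstoD) auto
    with less have "eventually (\<lambda>x. norm (S x - complex_of_real s)
        \<le> 2 / c * cmod ((S x)\<^sup>2 - (complex_of_real s)\<^sup>2)) F"
    proof eventually_elim
      case (elim x)
      have "complex_of_real (g + s) = (S x + complex_of_real s) + (G x - S x) + (complex_of_real g - G x)"
        by simp
      then have "cmod (complex_of_real (g + s))
          \<le> cmod (S x + complex_of_real s) + cmod (G x - S x) + cmod (complex_of_real g - G x)"
        by (metis norm_triangle_ineq norm_triangle_mono order_refl)
      moreover have "cmod (complex_of_real g - G x) < c / 2"
        using elim by (simp add: dist_norm norm_minus_commute)
      moreover have "cmod (complex_of_real (g + s)) = c + 1"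
        unfolding norm_of_real gs c_def by simp
      ultimately have *: "c / 2 \<le> cmod (S x + complex_of_real s)"
        using elim by linarith
      have "cmod ((S x)\<^sup>2 - (complex_of_real s)\<^sup>2)
          = cmod (S x - complex_of_real s) * cmod (S x + complex_of_real s)"
        by (simp add: norm_mult[symmetric] power2_eq_square algebra_simps)
      also have "\<dots> \<ge> cmod (S x - complex_of_real s) * (c / 2)"
        using * by (intro mult_left_mono) auto
      finally show ?case using c by (simp add: field_simps)
    qed
    then have "((\<lambda>x. S x - complex_of_real s) \<longlongrightarrow> 0) F"
      by (rule Lim_null_comparison[OF _ lim0])
    then show ?thesis by (simp add: LIM_zero_iff)
  qed
  then show ?thesis unfolding s_def .
qed

section \<open>Limits at the zeros of P_(N-1)\<close>

text \<open>The recurrence adds twice a square at each step to the start value 2. At a zero of P_n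
  this fixes the sign of P_(n+1) times the derivative of P_n.\<close>

lemma christoffel_darboux_pos:
  "poly (pderiv (Ppoly a N (Suc n))) x * poly (Ppoly a N n) x
     - poly (Ppoly a N (Suc n)) x * poly (pderiv (Ppoly a N n)) x > 0"
proof (induction n)
  case (Suc n)
  let ?p = "\<lambda>n. poly (Ppoly a N n) x" and ?d = "\<lambda>n. poly (pderiv (Ppoly a N n)) x"
  have "?d (Suc (Suc n)) * ?p (Suc n) - ?p (Suc (Suc n)) * ?d (Suc n)
      = 2 * (?p (Suc n))\<^sup>2 + (?d (Suc n) * ?p n - ?p (Suc n) * ?d n)"
    unfolding Ppoly.simps pderiv_diff pderiv_mult pderiv_pCons
    by (simp add: algebra_simps power2_eq_square)
  with Suc show ?case by (smt (verit) zero_le_power2)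
qed (simp add: pderiv_pCons)

text \<open>Real counterpart of \<open>casoratian\<close>; the 2 appears because
  \<open>Pstar\<close> is twice the second solution.\<close>

lemma Ppoly_Pstar_casoratian:
  "poly (Ppoly a N (Suc n)) x * poly (Pstar a N n) x
     - poly (Ppoly a N n) x * poly (Pstar a N (Suc n)) x = -2"
proof (induction n)
  case (Suc n)
  then show ?case by (simp add: algebra_simps)
qed simp

text \<open>At such a zero the Casoratian collapses to one product, making
  \<open>Pstar a N (N - 1)\<close> equal to -2 over P_N there.\<close>

lemma discr_poly_at_root:
  assumes "N \<ge> 1" "poly (Ppoly a N (N - 1)) y = 0"
  shows "poly (Ppoly a N N) y \<noteq> 0"
    and "poly (discr_poly a N) y = (poly (Ppoly a N N) y + 1 / poly (Ppoly a N N) y) / 2"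
    and "poly (Ppoly a N N) y * poly (pderiv (Ppoly a N (N - 1))) y < 0"
proof -
  obtain n where n: "N = Suc n" using assms(1) by (cases N) auto
  have w: "poly (Ppoly a N N) y * poly (Pstar a N (N - 1)) y = -2"
    using Ppoly_Pstar_casoratian[of a N n y] assms(2) by (simp add: n)
  then show nz: "poly (Ppoly a N N) y \<noteq> 0" by auto
  from w nz have "poly (Pstar a N (N - 1)) y = -2 / poly (Ppoly a N N) y"
    by (simp add: field_simps)
  then show "poly (discr_poly a N) y = (poly (Ppoly a N N) y + 1 / poly (Ppoly a N N) y) / 2"
    by (simp add: discr_poly_def)
  show "poly (Ppoly a N N) y * poly (pderiv (Ppoly a N (N - 1))) y < 0"
    using christoffel_darboux_pos[of a N n y] assms(2) by (simp add: n)
qed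

text \<open>Both \<open>p - g\<close> and the square root are half of \<open>p - 1 / p\<close> up to
  sign, and \<open>g\<close> has the sign of \<open>p\<close>. The two terms cancel for modulus of
  \<open>p\<close> at least 1 and add up otherwise; the sign of \<open>d\<close> then makes the
  quotient positive.\<close>

lemma joukowski_branch_value:
  fixes p g d :: real
  assumes "p \<noteq> 0" and g: "g = (p + 1 / p) / 2" and d: "p * d < 0"
  shows "\<bar>g\<bar> \<ge> 1"
    and "2 * (p - g - sgn g * sqrt (g\<^sup>2 - 1)) / d
       = (if \<bar>p\<bar> \<ge> 1 then 0 else 4 * sqrt \<bar>g\<^sup>2 - 1\<bar> / \<bar>d\<bar>)"
proof -
  have sq: "g\<^sup>2 - 1 = ((p - 1 / p) / 2)\<^sup>2"
    using assms(1) unfolding g by (simp add: field_simps power2_eq_square)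
  then have "g\<^sup>2 \<ge> 1" by (smt (verit) zero_le_power2)
  then show "\<bar>g\<bar> \<ge> 1" by (metis abs_le_square_iff abs_one one_power2)
  have pg: "p - g = (p - 1 / p) / 2" unfolding g by (simp add: field_simps)
  have rt: "sqrt (g\<^sup>2 - 1) = \<bar>p - 1 / p\<bar> / 2" "sqrt \<bar>g\<^sup>2 - 1\<bar> = \<bar>p - 1 / p\<bar> / 2"
    unfolding sq by (simp_all add: abs_divide)
  have sg: "sgn g = sgn p"
    unfolding g using assms(1) by (cases "p > 0") (auto simp: add_pos_pos add_neg_neg divide_neg_pos)
  show "2 * (p - g - sgn g * sqrt (g\<^sup>2 - 1)) / d
       = (if \<bar>p\<bar> \<ge> 1 then 0 else 4 * sqrt \<bar>g\<^sup>2 - 1\<bar> / \<bar>d\<bar>)"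
  proof (cases "p > 0")
    case True
    then have "d < 0" using d by (simp add: mult_less_0_iff)
    have "p \<ge> 1 / p \<longleftrightarrow> p \<ge> 1"
      using True by (simp add: field_simps) (smt (verit) mult_less_cancel_left2 mult_le_cancel_left2)
    then show ?thesis unfolding pg rt sg using True \<open>d < 0\<close>
      by (auto simp: abs_if field_simps)
  next
    case False
    with assms(1) have "p < 0" by simp
    then have "d > 0" using d by (simp add: mult_less_0_iff)
    have "p \<le> 1 / p \<longleftrightarrow> p \<le> -1"
      using \<open>p < 0\<close> by (simp add: field_simps) (smt (verit) mult_minus_left mult_less_cancel_left2 mult_le_cancel_left2 minus_mult_minus)
    then show ?thesis unfolding pg rt sg using \<open>p < 0\<close> \<open>d > 0\<close>
      by (auto simp: abs_if field_simps)
  qed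
qed

lemma isCont_cpoly: "isCont (cpoly p) z"
  by (intro continuous_intros)

text \<open>The factor \<open>z - y\<close> cancels one factor of P_(N-1) and leaves
  \<open>Q\<close>, with \<open>Q\<close> at \<open>y\<close> equal to the derivative of P_(N-1).
  Only the limit of the square root needs the unit disc criterion.\<close>

lemma phi_residue:
  assumes "N \<ge> 1"
    and roots: "proots ((discr_poly a N)\<^sup>2 - 1) = image_mset \<xi> (mset_set {1..2 * N})"
    and y: "poly (Ppoly a N (N - 1)) y = 0"
  shows "((\<lambda>z. (z - complex_of_real y) * phi a N z) \<longlongrightarrow>
           complex_of_real
             (if \<bar>poly (Ppoly a N N) y\<bar> \<ge> 1 then 0
              else 4 * sqrt \<bar>(poly (discr_poly a N) y)\<^sup>2 - 1\<bar> / \<bar>poly (pderiv (Ppoly a N (N - 1))) y\<bar>))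
          (at (complex_of_real y) within - \<real>)"
proof -
  define p where "p = poly (Ppoly a N N) y"
  define g where "g = poly (discr_poly a N) y"
  define d where "d = poly (pderiv (Ppoly a N (N - 1))) y"
  let ?F = "at (complex_of_real y) within - \<real>"
  have pgd: "p \<noteq> 0" "g = (p + 1 / p) / 2" "p * d < 0"
    using discr_poly_at_root[OF assms(1) y] by (simp_all add: p_def g_def d_def)
  obtain Q where Q: "Ppoly a N (N - 1) = [:- y, 1:] * Q"
    using y by (metis dvdE poly_eq_0_iff_dvd)
  have Qd: "poly Q y = d"
    unfolding d_def Q pderiv_mult by (simp add: pderiv_pCons)
  have lim_cpoly: "(cpoly r \<longlongrightarrow> complex_of_real (poly r y)) ?F" for r
    using isCont_cpoly[of "complex_of_real y" r] cpoly_of_real[of r y]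
    by (metis continuous_within continuous_at_imp_continuous_at_within)
  have nonreal: "eventually (\<lambda>z. Im z \<noteq> 0 \<and> z \<noteq> complex_of_real y) ?F"
    by (auto simp: eventually_at_topological complex_is_Real_iff)
  have S: "(sqrt_branch N \<xi> \<longlongrightarrow> complex_of_real (sgn g * sqrt (g\<^sup>2 - 1))) ?F"
  proof (rule tendsto_sqrt_of_norm_less_1)
    show "(cpoly (discr_poly a N) \<longlongrightarrow> complex_of_real g) ?F" unfolding g_def by (rule lim_cpoly)
    show "\<bar>g\<bar> \<ge> 1" using pgd by (rule joukowski_branch_value)
    show "eventually (\<lambda>z. (sqrt_branch N \<xi> z)\<^sup>2 = (cpoly (discr_poly a N) z)\<^sup>2 - 1) ?F"
      by (simp add: sqrt_branch_square[OF assms(1) roots])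
    show "eventually (\<lambda>z. cmod (cpoly (discr_poly a N) z - sqrt_branch N \<xi> z) < 1) ?F"
      using nonreal by eventually_elim (rule norm_discr_minus_sqrt_less_1[OF assms(1) _ roots], simp)
  qed
  have lim: "((\<lambda>z. 2 * (cpoly (Ppoly a N N) z - cpoly (discr_poly a N) z - sqrt_branch N \<xi> z) / cpoly Q z)
      \<longlongrightarrow> 2 * (complex_of_real p - complex_of_real g - complex_of_real (sgn g * sqrt (g\<^sup>2 - 1))) / complex_of_real d) ?F"
    using pgd(3)
    by (intro tendsto_intros lim_cpoly[of Q, unfolded Qd] lim_cpoly[of "Ppoly a N N", folded p_def]
        lim_cpoly[of "discr_poly a N", folded g_def] S) auto
  have val: "2 * (complex_of_real p - complex_of_real g - complex_of_real (sgn g * sqrt (g\<^sup>2 - 1))) / complex_of_real d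
      = complex_of_real (if \<bar>p\<bar> \<ge> 1 then 0 else 4 * sqrt \<bar>g\<^sup>2 - 1\<bar> / \<bar>d\<bar>)"
    unfolding joukowski_branch_value(2)[OF pgd, symmetric] by simp
  have "eventually (\<lambda>z. 2 * (cpoly (Ppoly a N N) z - cpoly (discr_poly a N) z - sqrt_branch N \<xi> z) / cpoly Q z
      = (z - complex_of_real y) * phi a N z) ?F"
    using nonreal
  proof eventually_elim
    case (elim z)
    have "cpoly (Ppoly a N (N - 1)) z = (z - complex_of_real y) * cpoly Q z"
      unfolding Q cpoly_mult by (simp add: cpoly_pCons)
    then show ?case
      using elim phi_eq[OF assms(1) _ roots, of z] by simp
  qed
  with lim have "((\<lambda>z. (z - complex_of_real y) * phi a N z) \<longlongrightarrow> complex_of_real (if \<bar>p\<bar> \<ge> 1 then 0 else 4 * sqrt \<bar>g\<^sup>2 - 1\<bar> / \<bar>d\<bar>)) ?F"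
    unfolding val by (rule Lim_transform_eventually)
  then show ?thesis unfolding p_def g_def d_def .
qed

section \<open>Signs at the zeros and local continuation\<close>

text \<open>The \<open>n\<close> distinct zeros already exhaust the degree, so each is simple and
  the root multiset is the root set.\<close>

lemma Ppoly_eq_prod:
  assumes inj: "inj_on y {1..n}" and zeros: "{x. poly (Ppoly a N n) x = 0} = y ` {1..n}"
  shows "Ppoly a N n = smult (2 ^ n) (\<Prod>j = 1..n. [:- y j, 1:])"
proof -
  let ?p = "Ppoly a N n"
  have nz: "?p \<noteq> 0" using lead_coeff_Ppoly[of a N n] by auto
  have sub: "mset_set (y ` {1..n}) \<subseteq># proots ?p"
  proof (rule mset_subset_eqI)
    fix x show "count (mset_set (y ` {1..n})) x \<le> count (proots ?p) x"
    proof (cases "x \<in> y ` {1..n}")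
      case True
      then have "x \<in># proots ?p" using nz zeros by simp
      then show ?thesis using True by (simp add: Suc_leI del: count_proots)
    qed simp
  qed
  have size: "size (mset_set (y ` {1..n})) = n"
    using inj by (simp add: card_image)
  have "size (proots ?p) \<le> n"
    using size_proots_le[of ?p] by (simp add: degree_Ppoly)
  then have roots: "proots ?p = mset_set (y ` {1..n})"
    using sub size by (metis mset_subset_size not_less subset_mset.le_imp_less_or_eq)
  have "?p = smult (lead_coeff ?p) (\<Prod>x\<in>#proots ?p. [:-x, 1:])"
    by (rule poly_eq_smult_prod_roots) (simp only: roots size degree_Ppoly)
  then show ?thesis
    unfolding lead_coeff_Ppoly roots
    using inj by (simp add: prod_unfold_prod_mset image_mset_mset_set[symmetric]
        image_mset.compositionality comp_def)
qed

text \<open>The derivative is a positive multiple of the product of the differences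
  \<open>y k - y j\<close>, of which the \<open>n - k\<close> with larger index are
  negative.\<close>

lemma sgn_pderiv_Ppoly:
  assumes mono: "strict_mono_on {1..n} y" and zeros: "{x. poly (Ppoly a N n) x = 0} = y ` {1..n}"
    and k: "k \<in> {1..n}"
  shows "sgn (poly (pderiv (Ppoly a N n)) (y k)) = (-1) ^ (n - k)"
proof -
  have inj: "inj_on y {1..n}" using mono by (rule strict_mono_on_imp_inj_on)
  define Q where "Q = smult (2 ^ n) (\<Prod>j \<in> {1..n} - {k}. [:- y j, 1:])"
  have P: "Ppoly a N n = [:- y k, 1:] * Q"
    unfolding Ppoly_eq_prod[OF inj zeros] Q_def
    using k by (subst prod.remove[of _ k]) auto
  have "poly (pderiv (Ppoly a N n)) (y k) = poly Q (y k)"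
    unfolding P pderiv_mult by (simp add: pderiv_pCons)
  also have "\<dots> = 2 ^ n * (\<Prod>j \<in> {1..n} - {k}. y k - y j)"
    by (simp add: Q_def poly_prod)
  also have "{1..n} - {k} = {1..<k} \<union> {k<..n}" using k by auto
  also have "(\<Prod>j \<in> {1..<k} \<union> {k<..n}. y k - y j)
      = (\<Prod>j \<in> {1..<k}. y k - y j) * (\<Prod>j \<in> {k<..n}. y k - y j)"
    by (intro prod.union_disjoint) auto
  also have "(\<Prod>j \<in> {k<..n}. y k - y j) = (-1) ^ (n - k) * (\<Prod>j \<in> {k<..n}. y j - y k)"
    by (subst prod_uminus[symmetric, where A = "{k<..n}" and f = "\<lambda>j. y j - y k", simplified]) auto
  finally have "poly (pderiv (Ppoly a N n)) (y k)
      = (-1) ^ (n - k) * (2 ^ n * ((\<Prod>j \<in> {1..<k}. y k - y j) * (\<Prod>j \<in> {k<..n}. y j - y k)))"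
    by (simp add: mult_ac)
  moreover have "(\<Prod>j \<in> {1..<k}. y k - y j) > 0" "(\<Prod>j \<in> {k<..n}. y j - y k) > 0"
    using k by (auto intro!: prod_pos strict_mono_onD[OF mono])
  ultimately show ?thesis
    by (cases "even (n - k)") (simp_all add: sgn_mult)
qed

lemma holomorphic_on_cpoly: "cpoly p holomorphic_on A"
  by (induction p) (auto simp: cpoly_pCons[abs_def] intro!: holomorphic_intros)

text \<open>The right-hand side continues the square root across the negative axis.\<close>

lemma csqrt_eq_ii_csqrt_uminus:
  assumes "\<sigma> * Im w > 0" "\<sigma> = 1 \<or> \<sigma> = -1"
  shows "csqrt w = complex_of_real \<sigma> * \<i> * csqrt (- w)"
  using assms(2)
proof
  assume "\<sigma> = 1"
  then show ?thesis using csqrt_minus[of "- w"] assms(1) by simp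
next
  assume "\<sigma> = -1"
  then have "csqrt (- w) = \<i> * csqrt w" using csqrt_minus[of w] assms(1) by simp
  then show ?thesis using \<open>\<sigma> = -1\<close> by simp
qed

text \<open>Near \<open>y\<close>, factors with \<open>\<xi> j < y\<close> are holomorphic. The
  others have \<open>y\<close> on their cut and are replaced by the continuation that agrees with
  them in the half-plane selected by \<open>\<sigma>\<close>.\<close>

lemma csqrt_product_extension:
  assumes J: "finite J" "\<And>j. j \<in> J \<Longrightarrow> \<xi> j \<noteq> y" and Q: "poly Q y \<noteq> 0"
    and \<sigma>: "\<sigma> = 1 \<or> \<sigma> = (-1 :: real)"
  shows "\<exists>r > 0. \<exists>F. F holomorphic_on ball (complex_of_real y) r \<and>
     (\<forall>z \<in> ball (complex_of_real y) r. \<sigma> * Im z > 0 \<longrightarrow>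
        F z = 2 * (cpoly H z - c * (\<Prod>j\<in>J. csqrt (z - complex_of_real (\<xi> j)))) / cpoly Q z)"
proof -
  let ?y = "complex_of_real y"
  have "cpoly Q ?y \<noteq> 0" using Q by (simp add: cpoly_of_real)
  \<comment> \<open>The radius keeps the denominator away from 0.\<close>
  then obtain e where e: "e > 0" "\<And>z. dist ?y z < e \<Longrightarrow> cpoly Q z \<noteq> 0"
    using continuous_at_avoid[OF isCont_cpoly[of ?y Q]] by blast
  \<comment> \<open>This radius keeps every branch point off the disc; \<open>Min\<close> of an
    empty set has no usable value, hence the case split.\<close>
  obtain r' where r': "r' > 0" "\<And>j. j \<in> J \<Longrightarrow> r' \<le> \<bar>\<xi> j - y\<bar>"
  proof (cases "J = {}")
    case False
    show ?thesis
      by (rule that[of "Min ((\<lambda>j. \<bar>\<xi> j - y\<bar>) ` J)"]) (use J False in auto)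
  qed (use that[of 1] in auto)
  define r where "r = min e r'"
  have r: "r > 0" "r \<le> e" "r \<le> r'" using e r' by (auto simp: r_def)
  define w where "w j z = (if \<xi> j < y then csqrt (z - complex_of_real (\<xi> j))
      else complex_of_real \<sigma> * \<i> * csqrt (- (z - complex_of_real (\<xi> j))))" for j z
  have Re: "\<bar>Re z - y\<bar> < r'" if "z \<in> ball ?y r" for z
    using that r abs_Re_le_cmod[of "?y - z"] by (simp add: dist_norm abs_minus_commute)
  have w_holo: "w j holomorphic_on ball ?y r" if j: "j \<in> J" for j
  proof (cases "\<xi> j < y")
    case True
    have "z - complex_of_real (\<xi> j) \<notin> \<real>\<^sub>\<le>\<^sub>0" if "z \<in> ball ?y r" for z
      using Re[OF that] r'(2)[OF j] True by (auto simp: complex_nonpos_Reals_iff)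
    then show ?thesis
      unfolding w_def using True by (auto intro!: holomorphic_intros)
  next
    case False
    have "- (z - complex_of_real (\<xi> j)) \<notin> \<real>\<^sub>\<le>\<^sub>0" if "z \<in> ball ?y r" for z
      using Re[OF that] r'(2)[OF j] False by (auto simp: complex_nonpos_Reals_iff)
    then show ?thesis
      unfolding w_def using False by (auto intro!: holomorphic_intros)
  qed
  define F where "F z = 2 * (cpoly H z - c * (\<Prod>j\<in>J. w j z)) / cpoly Q z" for z
  have "F holomorphic_on ball ?y r"
    unfolding F_def using r e
    by (intro holomorphic_intros holomorphic_on_cpoly w_holo) auto
  moreover have "F z = 2 * (cpoly H z - c * (\<Prod>j\<in>J. csqrt (z - complex_of_real (\<xi> j)))) / cpoly Q z"
    if "\<sigma> * Im z > 0" for z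
  proof -
    have "w j z = csqrt (z - complex_of_real (\<xi> j))" for j
      unfolding w_def using csqrt_eq_ii_csqrt_uminus[of \<sigma> "z - complex_of_real (\<xi> j)"] that \<sigma> by auto
    then show ?thesis unfolding F_def by simp
  qed
  ultimately show ?thesis using r(1) by blast
qed

section \<open>Closed form, point masses and removable singularities\<close>

theorem proposition6p1:
  fixes N :: nat and a :: real and \<xi> y :: "nat \<Rightarrow> real"
  assumes N: "N \<ge> 1"
    and xi_roots: "proots ((discr_poly a N)\<^sup>2 - 1) = image_mset \<xi> (mset_set {1..2 * N})"
    and xi_less: "\<And>j. j \<in> {1..N} \<Longrightarrow> \<xi> (2 * j - 1) < \<xi> (2 * j)"
    and xi_le: "\<And>j. j \<in> {1..<N} \<Longrightarrow> \<xi> (2 * j) \<le> \<xi> (2 * j + 1)"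
    and y_mono: "strict_mono_on {1..N - 1} y"
    and y_zeros: "{x. poly (Ppoly a N (N - 1)) x = 0} = y ` {1..N - 1}"
  shows "(\<forall>z. z \<notin> \<real> \<longrightarrow>
            cf_convergent a N z \<longlonglongrightarrow> phi a N z \<and>
            (\<lambda>n. cpoly (Pstar a N n) z / cpoly (Ppoly a N n) z) \<longlonglongrightarrow> phi a N z \<and>
            phi a N z = 2 * (cpoly (Ppoly a N N) z - cpoly (discr_poly a N) z - sqrt_branch N \<xi> z)
                          / cpoly (Ppoly a N (N - 1)) z \<and>
            (sqrt_branch N \<xi> z)\<^sup>2 = (cpoly (discr_poly a N) z)\<^sup>2 - 1)
       \<and> (\<forall>k \<in> {1..N - 1}.
            ((\<lambda>z. (z - complex_of_real (y k)) * phi a N z) \<longlongrightarrow>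
               complex_of_real
                 (if \<bar>poly (Ppoly a N N) (y k)\<bar> \<ge> 1 then 0
                  else 4 * sqrt \<bar>(poly (discr_poly a N) (y k))\<^sup>2 - 1\<bar>
                         / \<bar>poly (pderiv (Ppoly a N (N - 1))) (y k)\<bar>))
              (at (complex_of_real (y k)) within - \<real>))
       \<and> (\<forall>k \<in> {1..N - 1}. y k = \<xi> (2 * k) \<and> y k = \<xi> (2 * k + 1) \<longrightarrow>
            poly (Ppoly a N N) (y k) = (-1) ^ (N - k) \<and>
            poly (discr_poly a N) (y k) = (-1) ^ (N - k) \<and>
            removable_off_reals_at (phi a N) (y k) \<and>
            (\<exists>H Q. Ppoly a N N - discr_poly a N = [:- y k, 1:] * H \<and>
                   Ppoly a N (N - 1) = [:- y k, 1:] * Q \<and> poly Q (y k) \<noteq> 0 \<and>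
                   (\<forall>z. z \<notin> \<real> \<longrightarrow>
                      phi a N z =
                        2 * (cpoly H z - 2 ^ (N - 1) *
                              (\<Prod>j \<in> {1..2 * N} - {2 * k, 2 * k + 1}.
                                 csqrt (z - complex_of_real (\<xi> j))))
                          / cpoly Q z)))"
proof (intro conjI allI ballI impI)
  fix z :: complex assume "z \<notin> \<real>"
  then have z: "Im z \<noteq> 0" by (simp add: complex_is_Real_iff)
  show "cf_convergent a N z \<longlonglongrightarrow> phi a N z"
    using z by (rule tendsto_half_phi)
  show "(\<lambda>n. cpoly (Pstar a N n) z / cpoly (Ppoly a N n) z) \<longlonglongrightarrow> phi a N z"
    using tendsto_mult_left[OF tendsto_half_phi(1)[OF z], of 2]
    by (simp add: cpoly_Pstar cpoly_Ppoly del: jsol.simps)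
  show "phi a N z = 2 * (cpoly (Ppoly a N N) z - cpoly (discr_poly a N) z - sqrt_branch N \<xi> z)
      / cpoly (Ppoly a N (N - 1)) z"
    using N z xi_roots by (rule phi_eq)
  show "(sqrt_branch N \<xi> z)\<^sup>2 = (cpoly (discr_poly a N) z)\<^sup>2 - 1"
    using N xi_roots by (rule sqrt_branch_square)
next
  fix k assume "k \<in> {1..N - 1}"
  then have "poly (Ppoly a N (N - 1)) (y k) = 0" using y_zeros by auto
  with N xi_roots
  show "((\<lambda>z. (z - complex_of_real (y k)) * phi a N z) \<longlongrightarrow>
               complex_of_real
                 (if \<bar>poly (Ppoly a N N) (y k)\<bar> \<ge> 1 then 0
                  else 4 * sqrt \<bar>(poly (discr_poly a N) (y k))\<^sup>2 - 1\<bar>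
                         / \<bar>poly (pderiv (Ppoly a N (N - 1))) (y k)\<bar>))
              (at (complex_of_real (y k)) within - \<real>)"
    by (rule phi_residue)
next
  fix k assume k: "k \<in> {1..N - 1}" and "y k = \<xi> (2 * k) \<and> y k = \<xi> (2 * k + 1)"
  then have xi_y: "\<xi> (2 * k) = y k" "\<xi> (2 * k + 1) = y k" by auto
  define J where "J = {1..2 * N} - {2 * k, 2 * k + 1}"
  define p where "p = poly (Ppoly a N N) (y k)"
  define g where "g = poly (discr_poly a N) (y k)"
  define d where "d = poly (pderiv (Ppoly a N (N - 1))) (y k)"
  have y0: "poly (Ppoly a N (N - 1)) (y k) = 0" using k y_zeros by auto
  have pgd: "p \<noteq> 0" "g = (p + 1 / p) / 2" "p * d < 0"
    using discr_poly_at_root[OF N y0] by (simp_all add: p_def g_def d_def)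
  have J_un: "{1..2 * N} = insert (2 * k) (insert (2 * k + 1) J)" "2 * k + 1 \<notin> J" "2 * k \<notin> insert (2 * k + 1) J"
    using k by (auto simp: J_def)
  have "g\<^sup>2 - 1 = poly ((discr_poly a N)\<^sup>2 - 1) (y k)"
    by (simp add: g_def)
  also have "\<dots> = 0"
    unfolding discr_poly_square_eq_prod[OF N xi_roots] using k xi_y
    by (auto simp: poly_prod intro!: bexI[of _ "2 * k"])
  \<comment> \<open>With \<open>g = (p + 1 / p) / 2\<close>, the condition \<open>g^2 = 1\<close>
    becomes \<open>p = 1 / p\<close>.\<close>
  finally have "((p - 1 / p) / 2)\<^sup>2 = 0"
    using pgd(1) unfolding pgd(2) by (simp add: field_simps power2_eq_square)
  then have "p * p = 1" using pgd(1) by (simp add: field_simps)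
  then have abs_p: "\<bar>p\<bar> = 1" and pg: "g = p"
    using pgd by (auto simp: abs_square_eq_1 power2_eq_square square_eq_1_iff)
  \<comment> \<open>The sign of \<open>p\<close> is read off from the derivative of P_(N-1), whose
    sign alternates along its zeros.\<close>
  have "sgn p = - sgn d"
    using pgd(3) by (auto simp: mult_less_0_iff)
  also have "sgn d = (-1) ^ (N - 1 - k)"
    unfolding d_def using y_mono y_zeros k by (rule sgn_pderiv_Ppoly)
  also have "- ((-1) ^ (N - 1 - k)) = (-1 :: real) ^ Suc (N - 1 - k)" by simp
  also have "Suc (N - 1 - k) = N - k" using k by auto
  finally have sgn_p: "sgn p = (-1) ^ (N - k)" .
  then have p_val: "p = (-1) ^ (N - k)"
    using abs_p by (metis mult.right_neutral sgn_mult_abs)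
  then show "poly (Ppoly a N N) (y k) = (-1) ^ (N - k)" "poly (discr_poly a N) (y k) = (-1) ^ (N - k)"
    using pg by (simp_all add: p_def g_def)

  have "poly (Ppoly a N N - discr_poly a N) (y k) = 0"
    using pg by (simp add: p_def g_def)
  then obtain H where H: "Ppoly a N N - discr_poly a N = [:- y k, 1:] * H"
    by (metis dvdE poly_eq_0_iff_dvd)
  obtain Q where Q: "Ppoly a N (N - 1) = [:- y k, 1:] * Q"
    using y0 by (metis dvdE poly_eq_0_iff_dvd)
  have "poly Q (y k) = d"
    unfolding d_def Q pderiv_mult by (simp add: pderiv_pCons)
  then have Qy: "poly Q (y k) \<noteq> 0" using pgd(3) by auto
  have phi_reduced: "phi a N z = 2 * (cpoly H z - 2 ^ (N - 1) * (\<Prod>j \<in> J. csqrt (z - complex_of_real (\<xi> j)))) / cpoly Q z"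
    if z: "Im z \<noteq> 0" for z
  proof -
    define R where "R = (\<Prod>j \<in> J. csqrt (z - complex_of_real (\<xi> j)))"
    define u where "u = z - complex_of_real (y k)"
    have "u \<noteq> 0" using z by (auto simp: u_def)
    \<comment> \<open>The two factors at the double root are equal, so their product is exactly
      \<open>u\<close>, whatever the branch.\<close>
    have "sqrt_branch N \<xi> z = 2 ^ (N - 1) * (csqrt u * (csqrt u * R))"
      unfolding sqrt_branch_def J_un(1) R_def using J_un(2,3) xi_y by (simp add: J_def u_def)
    also have "\<dots> = 2 ^ (N - 1) * ((csqrt u)\<^sup>2 * R)"
      by (simp add: power2_eq_square)
    finally have s: "sqrt_branch N \<xi> z = u * (2 ^ (N - 1) * R)" by simp
    have "cpoly (Ppoly a N N) z - cpoly (discr_poly a N) z = u * cpoly H z"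
      unfolding cpoly_diff[symmetric] H cpoly_mult by (simp add: cpoly_pCons u_def)
    then have "phi a N z = 2 * (u * cpoly H z - u * (2 ^ (N - 1) * R)) / (u * cpoly Q z)"
      unfolding phi_eq[OF N z xi_roots] s Q cpoly_mult by (simp add: cpoly_pCons u_def)
    also have "\<dots> = u * (2 * (cpoly H z - 2 ^ (N - 1) * R)) / (u * cpoly Q z)"
      by (simp add: algebra_simps)
    finally show ?thesis using \<open>u \<noteq> 0\<close> by (simp add: R_def)
  qed
  have xi_step: "\<xi> i \<le> \<xi> (Suc i)" if "1 \<le> i" "Suc i \<le> 2 * N" for i
  proof (cases "even i")
    case True
    then obtain j where "i = 2 * j" by (elim evenE)
    then show ?thesis using xi_le[of j] that by auto
  next
    case False
    then obtain j where "i = 2 * j + 1" by (elim oddE)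
    then show ?thesis using xi_less[of "Suc j"] that by auto
  qed
  have xi_mono: "\<xi> i \<le> \<xi> j" if "1 \<le> i" "i \<le> j" "j \<le> 2 * N" for i j
    using that(2,3)
  proof (induction j rule: dec_induct)
    case (step n)
    then have "\<xi> i \<le> \<xi> n" by simp
    also have "\<dots> \<le> \<xi> (Suc n)" using step that(1) by (intro xi_step) auto
    finally show ?case .
  qed simp
  \<comment> \<open>The strict gaps just before \<open>\<xi> (2 * k)\<close> and just after
    \<open>\<xi> (2 * k + 1)\<close> exclude a third root at \<open>y k\<close>.\<close>
  have xi_ne: "\<xi> j \<noteq> y k" if "j \<in> J" for j
  proof (cases "j < 2 * k")
    case True
    then have "\<xi> j \<le> \<xi> (2 * k - 1)" using that k by (intro xi_mono) (auto simp: J_def)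
    also have "\<dots> < y k" using xi_less[of k] k xi_y by auto
    finally show ?thesis by simp
  next
    case False
    then have "y k < \<xi> (2 * Suc k)" using xi_less[of "Suc k"] k xi_y by auto
    also have "\<dots> \<le> \<xi> j" using that k False by (intro xi_mono) (auto simp: J_def)
    finally show ?thesis by simp
  qed
  have ext: "\<exists>r > 0. \<exists>F. F holomorphic_on ball (complex_of_real (y k)) r \<and>
     (\<forall>z \<in> ball (complex_of_real (y k)) r. \<sigma> * Im z > 0 \<longrightarrow> F z = phi a N z)"
    if \<sigma>: "\<sigma> = 1 \<or> \<sigma> = -1" for \<sigma>
  proof -
    have "finite J" by (simp add: J_def)
    from csqrt_product_extension[where \<xi> = \<xi> and H = H and c = "2 ^ (N - 1)", OF this xi_ne Qy \<sigma>]
    obtain r F where rF: "r > 0" "F holomorphic_on ball (complex_of_real (y k)) r"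
      "\<forall>z \<in> ball (complex_of_real (y k)) r. \<sigma> * Im z > 0 \<longrightarrow>
        F z = 2 * (cpoly H z - 2 ^ (N - 1) * (\<Prod>j\<in>J. csqrt (z - complex_of_real (\<xi> j)))) / cpoly Q z"
      by blast
    have "F z = phi a N z" if "z \<in> ball (complex_of_real (y k)) r" "\<sigma> * Im z > 0" for z
    proof -
      have "Im z \<noteq> 0" using that by auto
      then show ?thesis using rF(3) that phi_reduced by simp
    qed
    with rF show ?thesis by blast
  qed
  show "removable_off_reals_at (phi a N) (y k)"
    using ext[of 1] ext[of "-1"] unfolding removable_off_reals_at_def by simp
  show "\<exists>H Q. Ppoly a N N - discr_poly a N = [:- y k, 1:] * H \<and>
                   Ppoly a N (N - 1) = [:- y k, 1:] * Q \<and> poly Q (y k) \<noteq> 0 \<and>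
                   (\<forall>z. z \<notin> \<real> \<longrightarrow>
                      phi a N z =
                        2 * (cpoly H z - 2 ^ (N - 1) *
                              (\<Prod>j \<in> {1..2 * N} - {2 * k, 2 * k + 1}.
                                 csqrt (z - complex_of_real (\<xi> j))))
                          / cpoly Q z)"
    using H Q Qy phi_reduced unfolding J_def by (metis complex_is_Real_iff)
qed

end
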